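(* Let $\Gamma=N\rtimes_\sigma H$ with $N$ a discrete abelian group and $H$ a finite group of order $\kappa$. Let $\mathsf{f},\mathsf{g}\in\ell^2(\Gamma)$ have associated transfer matrices $\mathbf{F}(\xi)$ and $\mathbf{G}(\xi)$, $\xi\in\widehat N$, and assume that the entries of $\mathbf{F}(\xi)$ and $\mathbf{G}(\xi)$ belong to $L^\infty(\widehat{N})$. Then the systems $\{L_\gamma\mathsf{f}\}_{\gamma\in\Gamma}$ and $\{L_\gamma\mathsf{g}\}_{\gamma\in\Gamma}$ form a pair of dual Riesz bases (for $\ell^2(\Gamma)$) if and only if $\mathbf{G}(\xi)=[\mathbf{F}^*(\xi)]^{-1}$ for a.e. $\xi\in\widehat{N}$.
   Context: Setting: $(N,+)$ is a discrete abelian group, $(H,\cdot)$ is a finite group of order $\kappa$, $\sigma:H\to\mathrm{Aut}(N)$ is a homomorphism, and $\Gamma=N\rtimes_\sigma H$ is the set $N\times H$ with product $(n,h)(m,l)=(n+\sigma(h)(m),hl)$. The left regular representation of $\Gamma$ on the complex Hilbert space $\ell^2(\Gamma)$ is $L_\gamma\mathsf{f}(\eta)=\mathsf{f}(\gamma^{-1}\eta)$. $\widehat{N}$ is the (compact) dual group of $N$, with Haar measure normalized so that the Fourier transform $\widehat{\mathsf{a}}(\xi)=\sum_{n\in N}\mathsf{a}(n)\langle -n,\xi\rangle$, defined for $\mathsf{a}\in\ell^1(N)$, extends to a unitary operator $\ell^2(N)\to L^2(\widehat{N})$. Transfer matrix: for $\mathsf{f}\in\ell^2(\Gamma)$ and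 $h,l\in H$ put $\mathsf{f}_{h,l}(n):=\mathsf{f}[(0,l)^{-1}(n,h)]$, $n\in N$. The transfer matrix of $\mathsf{f}$ is $\mathbf{F}(\xi)=[\,\widehat{\mathsf{f}}_{h,l}(\xi)\,]_{h,l\in H}$ (row index $h$, column index $l$), and $\mathbf{F}^*(\xi)$ is its conjugate transpose; $\mathbf{G}$ is defined likewise from $\mathsf{g}$. A pair of dual Riesz bases is a pair of Riesz bases $\{x_\gamma\}$, $\{y_\gamma\}$ that are biorthogonal: $\langle x_\gamma,y_\eta\rangle=\delta_{\gamma,\eta}$. *)

theory Defs
  imports "HOL-Analysis.Analysis" "HOL-Algebra.Coset" "HOL-Algebra.Bij"
begin

section \<open>Semidirect products and the left regular representation\<close>

definition semidirect_product ::
  "('n, 'c) monoid_scheme \<Rightarrow> ('h, 'd) monoid_scheme \<Rightarrow> ('h \<Rightarrow> 'n \<Rightarrow> 'n) \<Rightarrow> ('n \<times> 'h) monoid"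
  where
  "semidirect_product N H \<sigma> =
    \<lparr>carrier = carrier N \<times> carrier H,
     mult = (\<lambda>(n, h) (m, l). (n \<otimes>\<^bsub>N\<^esub> \<sigma> h m, h \<otimes>\<^bsub>H\<^esub> l)),
     one = (\<one>\<^bsub>N\<^esub>, \<one>\<^bsub>H\<^esub>)\<rparr>"

text \<open>A function on a carrier set \<open>S\<close> is represented by its extension by zero, so that elements
  of \<open>ell2 S\<close> are equal iff they agree on \<open>S\<close>.\<close>

definition left_regular ::
  "('a, 'c) monoid_scheme \<Rightarrow> 'a \<Rightarrow> ('a \<Rightarrow> complex) \<Rightarrow> 'a \<Rightarrow> complex" where
  "left_regular G \<gamma> f = (\<lambda>\<eta>. if \<eta> \<in> carrier G then f (inv\<^bsub>G\<^esub> \<gamma> \<otimes>\<^bsub>G\<^esub> \<eta>) else 0)"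

section \<open>The Hilbert space of square-summable functions\<close>

definition ell2 :: "'a set \<Rightarrow> ('a \<Rightarrow> complex) set" where
  "ell2 S = {f. (\<forall>x. x \<notin> S \<longrightarrow> f x = 0) \<and> (\<lambda>x. (cmod (f x))\<^sup>2) summable_on S}"

definition ell2_inner :: "'a set \<Rightarrow> ('a \<Rightarrow> complex) \<Rightarrow> ('a \<Rightarrow> complex) \<Rightarrow> complex" where
  "ell2_inner S f g = (\<Sum>\<^sub>\<infinity>x\<in>S. f x * cnj (g x))"

definition ell2_norm :: "'a set \<Rightarrow> ('a \<Rightarrow> complex) \<Rightarrow> real" where
  "ell2_norm S f = sqrt (\<Sum>\<^sub>\<infinity>x\<in>S. (cmod (f x))\<^sup>2)"

definition bounded_operator :: "'a set \<Rightarrow> (('a \<Rightarrow> complex) \<Rightarrow> 'a \<Rightarrow> complex) \<Rightarrow> bool" where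
  "bounded_operator S T \<longleftrightarrow>
    (\<forall>f\<in>ell2 S. T f \<in> ell2 S) \<and>
    (\<forall>f\<in>ell2 S. \<forall>g\<in>ell2 S. T (\<lambda>x. f x + g x) = (\<lambda>x. T f x + T g x)) \<and>
    (\<forall>c. \<forall>f\<in>ell2 S. T (\<lambda>x. c * f x) = (\<lambda>x. c * T f x)) \<and>
    (\<exists>K. \<forall>f\<in>ell2 S. ell2_norm S (T f) \<le> K * ell2_norm S f)"

definition orthonormal_basis :: "'i set \<Rightarrow> 'a set \<Rightarrow> ('i \<Rightarrow> 'a \<Rightarrow> complex) \<Rightarrow> bool" where
  "orthonormal_basis I S e \<longleftrightarrow>
    (\<forall>i\<in>I. e i \<in> ell2 S) \<and>
    (\<forall>i\<in>I. \<forall>j\<in>I. ell2_inner S (e i) (e j) = (if i = j then 1 else 0)) \<and>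
    (\<forall>f\<in>ell2 S. \<forall>\<epsilon>>0. \<exists>A c. finite A \<and> A \<subseteq> I \<and>
       ell2_norm S (\<lambda>x. f x - (\<Sum>i\<in>A. c i * e i x)) < \<epsilon>)"

text \<open>A Riesz basis is the image of an orthonormal basis under a bounded bijective operator.\<close>

definition riesz_basis :: "'i set \<Rightarrow> 'a set \<Rightarrow> ('i \<Rightarrow> 'a \<Rightarrow> complex) \<Rightarrow> bool" where
  "riesz_basis I S x \<longleftrightarrow>
    (\<exists>e T. orthonormal_basis I S e \<and> bounded_operator S T \<and>
       bij_betw T (ell2 S) (ell2 S) \<and> (\<forall>i\<in>I. x i = T (e i)))"

definition dual_riesz_bases ::
  "'i set \<Rightarrow> 'a set \<Rightarrow> ('i \<Rightarrow> 'a \<Rightarrow> complex) \<Rightarrow> ('i \<Rightarrow> 'a \<Rightarrow> complex) \<Rightarrow> bool" where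
  "dual_riesz_bases I S x y \<longleftrightarrow>
    riesz_basis I S x \<and> riesz_basis I S y \<and>
    (\<forall>i\<in>I. \<forall>j\<in>I. ell2_inner S (x i) (y j) = (if i = j then 1 else 0))"

section \<open>The dual group and its Haar measure\<close>

definition circle_group :: "complex monoid" where
  "circle_group = \<lparr>carrier = sphere 0 1, mult = (*), one = 1\<rparr>"

text \<open>Every homomorphism from a discrete group is continuous. The pairing \<open>\<langle>n, \<xi>\<rangle>\<close> is
  the value \<open>\<xi> n\<close>.\<close>

definition dual_group :: "('n, 'c) monoid_scheme \<Rightarrow> ('n \<Rightarrow> complex) monoid" where
  "dual_group N =
    \<lparr>carrier = hom N circle_group \<inter> extensional (carrier N),
     mult = (\<lambda>\<xi> \<psi>. \<lambda>n\<in>carrier N. \<xi> n * \<psi> n),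
     one = (\<lambda>n\<in>carrier N. 1)\<rparr>"

text \<open>The compact subsets of a discrete group are the finite ones, so the compact-open topology
  on the dual group is the topology of pointwise convergence.\<close>

definition dual_topology :: "('n, 'c) monoid_scheme \<Rightarrow> ('n \<Rightarrow> complex) topology" where
  "dual_topology N =
    subtopology (product_topology (\<lambda>_. euclidean) (carrier N)) (carrier (dual_group N))"

text \<open>Left Haar measure: a nonzero, left-invariant Radon measure on the Borel sets of \<open>T\<close>.\<close>

definition haar_measure ::
  "('a, 'c) monoid_scheme \<Rightarrow> 'a topology \<Rightarrow> 'a measure \<Rightarrow> bool" where
  "haar_measure G T \<mu> \<longleftrightarrow>
    topspace T = carrier G \<and>
    sets \<mu> = sets (sigma (topspace T) {U. openin T U}) \<and>
    emeasure \<mu> (space \<mu>) \<noteq> 0 \<and>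
    (\<forall>x\<in>carrier G. \<forall>A\<in>sets \<mu>. emeasure \<mu> ((\<lambda>y. x \<otimes>\<^bsub>G\<^esub> y) ` A) = emeasure \<mu> A) \<and>
    (\<forall>K. compactin T K \<longrightarrow> emeasure \<mu> K < \<infinity>) \<and>
    (\<forall>A\<in>sets \<mu>. emeasure \<mu> A = (INF U\<in>{U. openin T U \<and> A \<subseteq> U}. emeasure \<mu> U)) \<and>
    (\<forall>U. openin T U \<longrightarrow> emeasure \<mu> U = (SUP K\<in>{K. compactin T K \<and> K \<subseteq> U}. emeasure \<mu> K))"

definition square_integrable :: "'a measure \<Rightarrow> ('a \<Rightarrow> complex) \<Rightarrow> bool" where
  "square_integrable \<mu> \<phi> \<longleftrightarrow>
    \<phi> \<in> borel_measurable \<mu> \<and> integrable \<mu> (\<lambda>\<xi>. (cmod (\<phi> \<xi>))\<^sup>2)"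

definition essentially_bounded :: "'a measure \<Rightarrow> ('a \<Rightarrow> complex) \<Rightarrow> bool" where
  "essentially_bounded \<mu> \<phi> \<longleftrightarrow>
    \<phi> \<in> borel_measurable \<mu> \<and> (\<exists>C. AE \<xi> in \<mu>. cmod (\<phi> \<xi>) \<le> C)"

section \<open>Fourier transform and transfer matrices\<close>

definition fourier_l1 :: "('n, 'c) monoid_scheme \<Rightarrow> ('n \<Rightarrow> complex) \<Rightarrow> ('n \<Rightarrow> complex) \<Rightarrow> complex"
  where
  "fourier_l1 N a \<xi> = (\<Sum>\<^sub>\<infinity>n\<in>carrier N. a n * \<xi> (inv\<^bsub>N\<^esub> n))"

text \<open>The continuous extension of \<open>fourier_l1\<close> to square-summable functions: the limit in
  \<open>L\<^sup>2(\<mu>)\<close> of the transforms of the finite truncations of \<open>a\<close>. It is determined up to a null set,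
  and one representative is chosen.\<close>

definition fourier_l2 ::
  "('n, 'c) monoid_scheme \<Rightarrow> ('n \<Rightarrow> complex) measure \<Rightarrow> ('n \<Rightarrow> complex) \<Rightarrow> ('n \<Rightarrow> complex) \<Rightarrow> complex"
  where
  "fourier_l2 N \<mu> a = (SOME \<phi>. square_integrable \<mu> \<phi> \<and>
     ((\<lambda>A. \<integral>\<xi>. (cmod (fourier_l1 N (\<lambda>n. if n \<in> A then a n else 0) \<xi> - \<phi> \<xi>))\<^sup>2 \<partial>\<mu>) \<longlongrightarrow> 0)
       (finite_subsets_at_top (carrier N)))"

definition transfer_component ::
  "('n, 'c) monoid_scheme \<Rightarrow> ('h, 'd) monoid_scheme \<Rightarrow> ('h \<Rightarrow> 'n \<Rightarrow> 'n) \<Rightarrow>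
   ('n \<times> 'h \<Rightarrow> complex) \<Rightarrow> 'h \<Rightarrow> 'h \<Rightarrow> 'n \<Rightarrow> complex" where
  "transfer_component N H \<sigma> f h l = (\<lambda>n. if n \<in> carrier N
     then f (inv\<^bsub>semidirect_product N H \<sigma>\<^esub> (\<one>\<^bsub>N\<^esub>, l) \<otimes>\<^bsub>semidirect_product N H \<sigma>\<^esub> (n, h))
     else 0)"

text \<open>Matrices with rows and columns indexed by a finite set are functions of row and column.\<close>

definition transfer_matrix ::
  "('n, 'c) monoid_scheme \<Rightarrow> ('h, 'd) monoid_scheme \<Rightarrow> ('h \<Rightarrow> 'n \<Rightarrow> 'n) \<Rightarrow>
   ('n \<Rightarrow> complex) measure \<Rightarrow> ('n \<times> 'h \<Rightarrow> complex) \<Rightarrow> ('n \<Rightarrow> complex) \<Rightarrow> 'h \<Rightarrow> 'h \<Rightarrow> complex" where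
  "transfer_matrix N H \<sigma> \<mu> f \<xi> h l = fourier_l2 N \<mu> (transfer_component N H \<sigma> f h l) \<xi>"

definition conjugate_transpose :: "('i \<Rightarrow> 'i \<Rightarrow> complex) \<Rightarrow> 'i \<Rightarrow> 'i \<Rightarrow> complex" where
  "conjugate_transpose A i j = cnj (A j i)"

definition is_inverse_matrix ::
  "'i set \<Rightarrow> ('i \<Rightarrow> 'i \<Rightarrow> complex) \<Rightarrow> ('i \<Rightarrow> 'i \<Rightarrow> complex) \<Rightarrow> bool" where
  "is_inverse_matrix I A B \<longleftrightarrow>
    (\<forall>i\<in>I. \<forall>j\<in>I. (\<Sum>k\<in>I. A i k * B k j) = (if i = j then 1 else 0)) \<and>
    (\<forall>i\<in>I. \<forall>j\<in>I. (\<Sum>k\<in>I. B i k * A k j) = (if i = j then 1 else 0))"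

end

(* Put K_f(z, y) = (L_y f)(z), and K_g likewise. Biorthogonality of the two systems says
   K_g^* K_f = 1 and completeness says K_f K_g^* = 1, entry by entry. On the component
   functions f_{h,l} the subgroup N acts by translation, so Parseval's identity makes the entries of the
   two products the Fourier coefficients of the entries of (G^* F) and (F G^* ).
   If G is the inverse of F^*, both products are therefore the identity; since the entries of F and G are
   bounded, K_f and K_g are bounded operators, hence mutually inverse up to adjoints, and they map the
   standard basis to the two systems.
   Conversely, duality gives every Fourier coefficient of D = G^* F - 1. Density of the
   trigonometric polynomials in L^2 is not needed to conclude D = 0: the entries of F and G are
   L^2-limits of trigonometric polynomials, and multiplying by a bounded limit of this kind preserves the property of
   being orthogonal to all characters, so D is orthogonal to itself. *)
theory Submission
  imports Defs "HOL-Algebra.Multiplicative_Group" "Jordan_Normal_Form.Determinant"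
begin

section \<open>Bounded matrices on square-summable functions\<close>

text \<open>Several gaps lie beneath this argument. \<open>fourier_l2\<close> is defined by choice,
  so it says nothing about its value until the truncations are shown to have an L^2 limit; this is
  the Riesz-Fischer theorem, carried out with an almost everywhere convergent subsequence and
  Fatou's lemma. Parseval's identity rests on the orthogonality of characters, hence on a character
  that is not 1 at a given n other than the identity; it comes from extending a homomorphism off the
  cyclic subgroup of n, which is possible because the circle is divisible. On the operator side, a
  product identity between infinite matrices cannot be applied to a vector by rearranging a double
  series. Boundedness is therefore stated for finitely supported vectors, and operator identities
  are checked on the standard basis and extended by continuity. Finiteness of H enters at three
  points: the matrix of a system is a finite array of convolution blocks whose bounds add up, the
  one-sided identity coming from biorthogonality is a two-sided inverse, and the exceptional null
  sets of the entries can be united.\<close>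

definition delta :: "'a \<Rightarrow> 'a \<Rightarrow> complex" where
  "delta a = (\<lambda>x. if x = a then 1 else 0)"

lemma ell2_summable: "f \<in> ell2 S \<Longrightarrow> (\<lambda>x. (cmod (f x))\<^sup>2) summable_on S"
  and ell2_outside: "f \<in> ell2 S \<Longrightarrow> x \<notin> S \<Longrightarrow> f x = 0"
  by (auto simp: ell2_def)

lemma ell2_norm_nonneg: "0 \<le> ell2_norm S f"
  unfolding ell2_norm_def by (intro real_sqrt_ge_zero infsum_nonneg) auto

lemma ell2_norm_sq: "(ell2_norm S f)\<^sup>2 = (\<Sum>\<^sub>\<infinity>x\<in>S. (cmod (f x))\<^sup>2)"
  unfolding ell2_norm_def by (intro real_sqrt_pow2 infsum_nonneg) auto

lemma ell2_prod_summable: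
  assumes "(\<lambda>x. (cmod (f x))\<^sup>2) summable_on S" "(\<lambda>x. (cmod (g x))\<^sup>2) summable_on S"
  shows "(\<lambda>x. cmod (f x * g x)) summable_on S"
  by (rule abs_summable_product) (use assms in \<open>simp_all add: norm_mult power2_eq_square\<close>)

lemma ell2_inner_summable:
  assumes "f \<in> ell2 S" "g \<in> ell2 S"
  shows "(\<lambda>x. f x * cnj (g x)) summable_on S"
  using ell2_prod_summable[of f S "\<lambda>x. cnj (g x)"] assms
  by (simp add: ell2_summable abs_summable_summable)

lemma ell2_scale: "f \<in> ell2 S \<Longrightarrow> (\<lambda>x. c * f x) \<in> ell2 S"
  by (auto simp: ell2_def norm_mult power_mult_distrib intro!: summable_on_cmult_right)

lemma ell2_add:
  assumes f: "f \<in> ell2 S" and g: "g \<in> ell2 S"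
  shows "(\<lambda>x. f x + g x) \<in> ell2 S"
proof -
  have "(\<lambda>x. 2 * (cmod (f x))\<^sup>2 + 2 * (cmod (g x))\<^sup>2) summable_on S"
    using f g by (intro summable_on_add summable_on_cmult_right ell2_summable)
  moreover have "(cmod (f x + g x))\<^sup>2 \<le> 2 * (cmod (f x))\<^sup>2 + 2 * (cmod (g x))\<^sup>2" for x
  proof -
    have "(cmod (f x + g x))\<^sup>2 \<le> (cmod (f x) + cmod (g x))\<^sup>2"
      by (intro power_mono norm_triangle_ineq) auto
    also have "\<dots> \<le> 2 * (cmod (f x))\<^sup>2 + 2 * (cmod (g x))\<^sup>2"
      using sum_squares_bound[of "cmod (f x)" "cmod (g x)"] by (simp add: power2_sum)
    finally show ?thesis .
  qed
  ultimately have "(\<lambda>x. (cmod (f x + g x))\<^sup>2) summable_on S"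
    by (rule summable_on_comparison_test) auto
  then show ?thesis using f g by (auto simp: ell2_def)
qed

lemma ell2_diff:
  assumes f: "f \<in> ell2 S" and g: "g \<in> ell2 S"
  shows "(\<lambda>x. f x - g x) \<in> ell2 S"
  using ell2_add[OF f ell2_scale[OF g, of "-1"]] by simp

lemma ell2_zero: "(\<lambda>x. 0) \<in> ell2 S"
  by (auto simp: ell2_def)

lemma ell2_delta: "y \<in> S \<Longrightarrow> delta y \<in> ell2 S"
proof -
  assume "y \<in> S"
  then have "(\<lambda>x. (cmod (delta y x))\<^sup>2) summable_on S \<longleftrightarrow> (\<lambda>x. (cmod (delta y x))\<^sup>2) summable_on {y}"
    by (intro summable_on_cong_neutral) (auto simp: delta_def)
  with \<open>y \<in> S\<close> show ?thesis by (auto simp: ell2_def delta_def)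
qed

lemma ell2_finite_combination:
  "finite A \<Longrightarrow> A \<subseteq> S \<Longrightarrow> (\<lambda>x. \<Sum>i\<in>A. c i * delta i x) \<in> ell2 S"
  by (induction rule: finite_induct) (auto simp: ell2_zero intro!: ell2_add ell2_scale ell2_delta)

lemma L2_set_le_ell2_norm:
  assumes "(\<lambda>x. (cmod (f x))\<^sup>2) summable_on S" "finite A" "A \<subseteq> S"
  shows "L2_set (\<lambda>x. cmod (f x)) A \<le> ell2_norm S f"
  unfolding L2_set_def ell2_norm_def using assms
  by (intro real_sqrt_le_mono finite_sum_le_infsum) auto

text \<open>Uniform bounds on finite sections give membership and the norm estimate together, so an
  operator can be controlled before its values are known to be square-summable. The empty section
  forces C to be nonnegative.\<close>

lemma ell2I_L2_set:
  assumes out: "\<And>x. x \<notin> S \<Longrightarrow> f x = 0"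
    and bd: "\<And>A. finite A \<Longrightarrow> A \<subseteq> S \<Longrightarrow> L2_set (\<lambda>x. cmod (f x)) A \<le> C"
  shows "f \<in> ell2 S" "ell2_norm S f \<le> C"
proof -
  have C: "0 \<le> C" using bd[of "{}"] by simp
  have *: "(\<Sum>x\<in>A. (cmod (f x))\<^sup>2) \<le> C\<^sup>2" if "finite A" "A \<subseteq> S" for A
    using bd[OF that] C unfolding L2_set_def
    by (metis real_sqrt_le_iff real_sqrt_unique)
  have "(\<lambda>x. (cmod (f x))\<^sup>2) summable_on S"
    by (intro nonneg_bdd_above_summable_on bdd_aboveI2[where M = "C\<^sup>2"]) (auto intro: *)
  moreover from this have "(\<Sum>\<^sub>\<infinity>x\<in>S. (cmod (f x))\<^sup>2) \<le> C\<^sup>2"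
    by (intro infsum_le_finite_sums) (auto intro: *)
  ultimately show "f \<in> ell2 S" "ell2_norm S f \<le> C"
    using out C unfolding ell2_norm_def by (auto simp: ell2_def intro: real_le_lsqrt infsum_nonneg)
qed

lemma ell2_inner_Cauchy_Schwarz:
  assumes f: "f \<in> ell2 S" and g: "g \<in> ell2 S"
  shows "cmod (ell2_inner S f g) \<le> ell2_norm S f * ell2_norm S g"
proof -
  have lim: "((\<lambda>A. cmod (\<Sum>x\<in>A. f x * cnj (g x))) \<longlongrightarrow> cmod (ell2_inner S f g))
      (finite_subsets_at_top S)"
    unfolding ell2_inner_def
    by (intro tendsto_norm infsum_tendsto ell2_inner_summable f g)
  have "cmod (\<Sum>x\<in>A. f x * cnj (g x)) \<le> ell2_norm S f * ell2_norm S g"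
    if "finite A" "A \<subseteq> S" for A
  proof -
    have "cmod (\<Sum>x\<in>A. f x * cnj (g x)) \<le> (\<Sum>x\<in>A. \<bar>cmod (f x)\<bar> * \<bar>cmod (g x)\<bar>)"
      by (rule order_trans[OF norm_sum]) (simp add: norm_mult)
    also have "\<dots> \<le> L2_set (\<lambda>x. cmod (f x)) A * L2_set (\<lambda>x. cmod (g x)) A"
      by (rule L2_set_mult_ineq)
    also have "\<dots> \<le> ell2_norm S f * ell2_norm S g"
      using that f g
      by (intro mult_mono L2_set_le_ell2_norm ell2_norm_nonneg L2_set_nonneg ell2_summable) auto
    finally show ?thesis .
  qed
  then show ?thesis
    by (intro tendsto_upperbound[OF lim] eventually_finite_subsets_at_top_weakI) auto
qed

lemma ell2_inner_add_left:
  assumes "f \<in> ell2 S" "g \<in> ell2 S" "h \<in> ell2 S"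
  shows "ell2_inner S (\<lambda>x. f x + g x) h = ell2_inner S f h + ell2_inner S g h"
  unfolding ell2_inner_def distrib_right using assms
  by (intro infsum_add ell2_inner_summable)

lemma ell2_inner_scale_left:
  assumes "f \<in> ell2 S" "h \<in> ell2 S"
  shows "ell2_inner S (\<lambda>x. c * f x) h = c * ell2_inner S f h"
  unfolding ell2_inner_def mult.assoc using assms
  by (intro infsum_cmult_right ell2_inner_summable)

lemma infsum_mult_delta:
  assumes "y \<in> S"
  shows "(\<Sum>\<^sub>\<infinity>x\<in>S. f x * delta y x) = f y"
proof -
  have "(\<Sum>\<^sub>\<infinity>x\<in>S. f x * delta y x) = (\<Sum>\<^sub>\<infinity>x\<in>{y}. f x * delta y x)"
    using assms by (intro infsum_cong_neutral) (auto simp: delta_def)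
  then show ?thesis by (simp add: delta_def)
qed

lemma ell2_inner_delta_right: "y \<in> S \<Longrightarrow> ell2_inner S f (delta y) = f y"
  using infsum_mult_delta[of y S f] unfolding ell2_inner_def
  by (simp add: delta_def if_distrib[of cnj] cong: if_cong)

lemma ell2_finite_approximation:
  assumes f: "f \<in> ell2 S" and e: "\<epsilon> > 0"
  shows "\<exists>A. finite A \<and> A \<subseteq> S \<and> ell2_norm S (\<lambda>x. f x - (\<Sum>i\<in>A. f i * delta i x)) < \<epsilon>"
proof -
  let ?q = "\<lambda>x. (cmod (f x))\<^sup>2"
  \<comment> \<open>The approximation of the infinite sum is non-strict, hence the factor 1/2; the
    tail of the squares then stays strictly below \<epsilon> squared.\<close>
  obtain A where A: "finite A" "A \<subseteq> S" "dist (sum ?q A) (infsum ?q S) \<le> \<epsilon>\<^sup>2/2"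
    using infsum_finite_approximation[OF ell2_summable[OF f], of "\<epsilon>\<^sup>2/2"] e by auto
  have "f x - (\<Sum>i\<in>A. f i * delta i x) = (if x \<in> A then 0 else f x)" for x
    using A by (auto simp: delta_def if_distrib[of "\<lambda>u. _ * u"] cong: if_cong)
  then have "(ell2_norm S (\<lambda>x. f x - (\<Sum>i\<in>A. f i * delta i x)))\<^sup>2 = infsum ?q (S - A)"
    unfolding ell2_norm_sq by (auto intro!: infsum_cong_neutral)
  also have "infsum ?q S = infsum ?q A + infsum ?q (S - A)"
    using infsum_Un_disjoint[of ?q A "S - A"] A(1,2)
      summable_on_subset_banach[OF ell2_summable[OF f], of "S - A"]
    by (simp add: Un_absorb1)
  then have "infsum ?q (S - A) = infsum ?q S - sum ?q A" using A by simp
  also have "\<dots> < \<epsilon>\<^sup>2"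
  proof -
    have "\<epsilon>\<^sup>2 > 0" using e by simp
    then show ?thesis using A(3) unfolding dist_real_def by linarith
  qed
  finally have "ell2_norm S (\<lambda>x. f x - (\<Sum>i\<in>A. f i * delta i x)) < \<epsilon>"
    using e by (simp add: power2_less_imp_less)
  then show ?thesis using A by blast
qed

lemma delta_orthonormal_basis: "orthonormal_basis S S delta"
  unfolding orthonormal_basis_def
proof (intro conjI ballI allI impI)
  fix f :: "'a \<Rightarrow> complex" and \<epsilon> :: real assume "f \<in> ell2 S" "0 < \<epsilon>"
  then obtain A where "finite A \<and> A \<subseteq> S \<and> ell2_norm S (\<lambda>x. f x - (\<Sum>i\<in>A. f i * delta i x)) < \<epsilon>"
    using ell2_finite_approximation[of f S \<epsilon>] by auto
  then show "\<exists>A c. finite A \<and> A \<subseteq> S \<and> ell2_norm S (\<lambda>x. f x - (\<Sum>i\<in>A. c i * delta i x)) < \<epsilon>"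
    by (intro exI[of _ A] exI[of _ f])
qed (simp_all add: ell2_delta ell2_inner_delta_right, simp add: delta_def)

text \<open>Finitely supported vectors are dense, and the bound carries the zero from them to h.
  Linearity is asked for on \<open>ell2 S\<close> only, where the infinite sums behind the intended
  functionals are known to converge.\<close>

lemma bounded_functional_eq_0:
  assumes add: "\<And>f g. f \<in> ell2 S \<Longrightarrow> g \<in> ell2 S \<Longrightarrow> \<Phi> (\<lambda>x. f x + g x) = \<Phi> f + \<Phi> g"
    and scale: "\<And>c f. f \<in> ell2 S \<Longrightarrow> \<Phi> (\<lambda>x. c * f x) = c * \<Phi> f"
    and bd: "\<And>f. f \<in> ell2 S \<Longrightarrow> cmod (\<Phi> f) \<le> C * ell2_norm S f"
    and delta: "\<And>y. y \<in> S \<Longrightarrow> \<Phi> (delta y) = 0"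
    and h: "h \<in> ell2 S"
  shows "\<Phi> h = 0"
proof (rule ccontr)
  assume neq: "\<Phi> h \<noteq> 0"
  \<comment> \<open>Adding 1 makes the constant positive, so that the accuracy can be divided by
    it.\<close>
  define D where "D = \<bar>C\<bar> + 1"
  have D: "D > 0" by (simp add: D_def add_nonneg_pos)
  have fin: "\<Phi> (\<lambda>x. \<Sum>i\<in>A. c i * delta i x) = 0" if "finite A" "A \<subseteq> S" for A c
    using that
  proof (induction rule: finite_induct)
    case empty
    show ?case using scale[OF ell2_zero, of 0] by simp
  next
    case (insert a A)
    then show ?case
      by (simp add: add scale delta ell2_scale ell2_delta ell2_finite_combination)
  qed
  obtain A where A: "finite A" "A \<subseteq> S"
    "ell2_norm S (\<lambda>x. h x - (\<Sum>i\<in>A. h i * delta i x)) < cmod (\<Phi> h) / D"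
    using ell2_finite_approximation[OF h, of "cmod (\<Phi> h) / D"] neq D by auto
  let ?p = "\<lambda>x. \<Sum>i\<in>A. h i * delta i x"
  have p: "?p \<in> ell2 S" using A by (simp add: ell2_finite_combination)
  have "\<Phi> h = \<Phi> (\<lambda>x. h x - ?p x) + \<Phi> ?p"
    using add[OF ell2_diff[OF h p] p] by simp
  then have "cmod (\<Phi> h) = cmod (\<Phi> (\<lambda>x. h x - ?p x))" using fin[OF A(1,2)] by simp
  also have "\<dots> \<le> C * ell2_norm S (\<lambda>x. h x - ?p x)" by (intro bd ell2_diff h p)
  also have "\<dots> \<le> D * ell2_norm S (\<lambda>x. h x - ?p x)"
    by (intro mult_right_mono ell2_norm_nonneg) (simp add: D_def)
  also have "\<dots> < cmod (\<Phi> h)" using A(3) D by (simp add: field_simps)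
  finally show False by simp
qed

section \<open>Operators given by infinite matrices\<close>

definition matrix_operator :: "'a set \<Rightarrow> ('a \<Rightarrow> 'a \<Rightarrow> complex) \<Rightarrow> ('a \<Rightarrow> complex) \<Rightarrow> 'a \<Rightarrow> complex" where
  "matrix_operator S K h = (\<lambda>x. if x \<in> S then \<Sum>\<^sub>\<infinity>y\<in>S. K x y * h y else 0)"

text \<open>The operator norm bound is expressed through the sesquilinear form on finitely supported
  vectors. No convergence enters, the condition is symmetric under passing to the adjoint, and
  finite forms are what integrals of trigonometric polynomials compute.\<close>

definition bounded_matrix :: "'a set \<Rightarrow> real \<Rightarrow> ('a \<Rightarrow> 'a \<Rightarrow> complex) \<Rightarrow> bool" where
  "bounded_matrix S C K \<longleftrightarrow>
    (\<forall>A B c d. finite A \<longrightarrow> finite B \<longrightarrow> A \<subseteq> S \<longrightarrow> B \<subseteq> S \<longrightarrow>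
      cmod (\<Sum>x\<in>A. \<Sum>y\<in>B. K x y * c y * cnj (d x))
        \<le> C * L2_set (\<lambda>y. cmod (c y)) B * L2_set (\<lambda>x. cmod (d x)) A)"

lemma bounded_matrix_adjoint:
  assumes "bounded_matrix S C K"
  shows "bounded_matrix S C (\<lambda>x y. cnj (K y x))"
  unfolding bounded_matrix_def
proof (intro allI impI)
  fix A B c d assume "finite A" "finite B" "A \<subseteq> S" "B \<subseteq> S"
  then have "cmod (\<Sum>x\<in>B. \<Sum>y\<in>A. K x y * d y * cnj (c x))
        \<le> C * L2_set (\<lambda>x. cmod (d x)) A * L2_set (\<lambda>y. cmod (c y)) B"
    using assms unfolding bounded_matrix_def by blast
  also have "(\<Sum>x\<in>B. \<Sum>y\<in>A. K x y * d y * cnj (c x))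
      = cnj (\<Sum>x\<in>A. \<Sum>y\<in>B. cnj (K y x) * c y * cnj (d x))"
    by (subst sum.swap) (simp add: mult_ac)
  finally show "cmod (\<Sum>x\<in>A. \<Sum>y\<in>B. cnj (K y x) * c y * cnj (d x))
        \<le> C * L2_set (\<lambda>y. cmod (c y)) B * L2_set (\<lambda>x. cmod (d x)) A"
    by (simp add: mult_ac del: cnj_sum)
qed

text \<open>Duality of the Euclidean norm: tested against the output vector \<open>d\<close> itself,
  the form becomes the square of its norm, and one factor cancels.\<close>

lemma bounded_matrix_finite:
  assumes "bounded_matrix S C K" "0 \<le> C" "finite A" "finite B" "A \<subseteq> S" "B \<subseteq> S"
  shows "L2_set (\<lambda>x. cmod (\<Sum>y\<in>B. K x y * c y)) A \<le> C * L2_set (\<lambda>y. cmod (c y)) B"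
proof -
  define d where "d = (\<lambda>x. \<Sum>y\<in>B. K x y * c y)"
  let ?n = "L2_set (\<lambda>x. cmod (d x)) A"
  have "(\<Sum>x\<in>A. \<Sum>y\<in>B. K x y * c y * cnj (d x)) = (\<Sum>x\<in>A. d x * cnj (d x))"
    by (simp add: d_def sum_distrib_right)
  also have "\<dots> = of_real (\<Sum>x\<in>A. (cmod (d x))\<^sup>2)"
    by (simp add: complex_norm_square[symmetric])
  also have "(\<Sum>x\<in>A. (cmod (d x))\<^sup>2) = ?n\<^sup>2"
    unfolding L2_set_def by (simp add: sum_nonneg)
  finally have "cmod (\<Sum>x\<in>A. \<Sum>y\<in>B. K x y * c y * cnj (d x)) = ?n\<^sup>2"
    by (simp add: norm_power L2_set_nonneg)
  moreover have "cmod (\<Sum>x\<in>A. \<Sum>y\<in>B. K x y * c y * cnj (d x))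
      \<le> C * L2_set (\<lambda>y. cmod (c y)) B * ?n"
    using assms unfolding bounded_matrix_def by blast
  ultimately have "?n\<^sup>2 \<le> C * L2_set (\<lambda>y. cmod (c y)) B * ?n"
    by simp
  then have "?n \<le> C * L2_set (\<lambda>y. cmod (c y)) B"
    using assms(2) by (cases "?n = 0") (auto simp: power2_eq_square L2_set_nonneg less_le)
  then show ?thesis by (simp add: d_def)
qed

text \<open>Column y is the image of the unit vector at y, so each of its finite sections has norm
  at most C.\<close>

lemma bounded_matrix_column:
  assumes "bounded_matrix S C K" "0 \<le> C" "y \<in> S"
  shows "(\<lambda>x. if x \<in> S then K x y else 0) \<in> ell2 S"
proof (rule ell2I_L2_set(1))
  fix A assume "finite A" "A \<subseteq> S"
  then have "L2_set (\<lambda>x. cmod (\<Sum>y\<in>{y}. K x y * 1)) A \<le> C * L2_set (\<lambda>y. cmod 1) {y}"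
    using assms by (intro bounded_matrix_finite) auto
  moreover have "L2_set (\<lambda>x. cmod (if x \<in> S then K x y else 0)) A = L2_set (\<lambda>x. cmod (K x y)) A"
    using \<open>A \<subseteq> S\<close> by (intro L2_set_cong) auto
  ultimately show "L2_set (\<lambda>x. cmod (if x \<in> S then K x y else 0)) A \<le> C"
    by simp
qed auto

lemma bounded_matrix_row_summable:
  assumes "bounded_matrix S C K" "0 \<le> C" "x \<in> S" "h \<in> ell2 S"
  shows "(\<lambda>y. K x y * h y) summable_on S"
proof -
  have "(\<lambda>y. if y \<in> S then cnj (K x y) else 0) \<in> ell2 S"
    using bounded_matrix_column[OF bounded_matrix_adjoint[OF assms(1)] assms(2,3)] by simp
  then have "(\<lambda>y. (cmod (if y \<in> S then cnj (K x y) else 0))\<^sup>2) summable_on S"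
    by (rule ell2_summable)
  then have "(\<lambda>y. (cmod (K x y))\<^sup>2) summable_on S"
    by (simp cong: summable_on_cong)
  then show ?thesis
    by (rule abs_summable_summable[OF ell2_prod_summable[OF _ ell2_summable[OF assms(4)]]])
qed

text \<open>For a fixed finite output section A only finitely many rows are involved, so the bound
  for finite B survives the limit over B; afterwards A is arbitrary.\<close>

lemma matrix_operator_ell2:
  assumes K: "bounded_matrix S C K" "0 \<le> C" and h: "h \<in> ell2 S"
  shows "matrix_operator S K h \<in> ell2 S"
    and "ell2_norm S (matrix_operator S K h) \<le> C * ell2_norm S h"
proof -
  have bd: "L2_set (\<lambda>x. cmod (matrix_operator S K h x)) A \<le> C * ell2_norm S h"
    if A: "finite A" "A \<subseteq> S" for A
  proof (rule tendsto_upperbound)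
    show "((\<lambda>B. L2_set (\<lambda>x. cmod (\<Sum>y\<in>B. K x y * h y)) A) \<longlongrightarrow>
        L2_set (\<lambda>x. cmod (matrix_operator S K h x)) A) (finite_subsets_at_top S)"
      unfolding L2_set_def
    proof (intro tendsto_real_sqrt tendsto_sum tendsto_power tendsto_norm)
      fix x assume "x \<in> A"
      then have "x \<in> S" using A by auto
      then show "((\<lambda>B. \<Sum>y\<in>B. K x y * h y) \<longlongrightarrow> matrix_operator S K h x) (finite_subsets_at_top S)"
        using infsum_tendsto[OF bounded_matrix_row_summable[OF K _ h], of x]
        by (simp add: matrix_operator_def)
    qed
    show "\<forall>\<^sub>F B in finite_subsets_at_top S.
        L2_set (\<lambda>x. cmod (\<Sum>y\<in>B. K x y * h y)) A \<le> C * ell2_norm S h"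
    proof (rule eventually_finite_subsets_at_top_weakI)
      fix B assume "finite B" "B \<subseteq> S"
      then have "L2_set (\<lambda>x. cmod (\<Sum>y\<in>B. K x y * h y)) A \<le> C * L2_set (\<lambda>y. cmod (h y)) B"
        using K A by (intro bounded_matrix_finite)
      also have "\<dots> \<le> C * ell2_norm S h"
        using K \<open>finite B\<close> \<open>B \<subseteq> S\<close> h
        by (intro mult_left_mono L2_set_le_ell2_norm ell2_summable)
      finally show "L2_set (\<lambda>x. cmod (\<Sum>y\<in>B. K x y * h y)) A \<le> C * ell2_norm S h" .
    qed
  qed auto
  have out: "matrix_operator S K h x = 0" if "x \<notin> S" for x
    using that by (simp add: matrix_operator_def)
  show "matrix_operator S K h \<in> ell2 S" by (rule ell2I_L2_set[OF out bd])
  show "ell2_norm S (matrix_operator S K h) \<le> C * ell2_norm S h"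
    by (rule ell2I_L2_set[OF out bd])
qed

lemma matrix_operator_bounded_operator:
  assumes K: "bounded_matrix S C K" "0 \<le> C"
  shows "bounded_operator S (matrix_operator S K)"
  unfolding bounded_operator_def
proof (intro conjI ballI allI exI)
  fix f g :: "'a \<Rightarrow> complex" and c assume f: "f \<in> ell2 S" 
  show "matrix_operator S K f \<in> ell2 S" "ell2_norm S (matrix_operator S K f) \<le> C * ell2_norm S f"
    using matrix_operator_ell2[OF K f] .
  have sum: "(\<lambda>y. K x y * f y) summable_on S" if "x \<in> S" "f \<in> ell2 S" for f x
    using bounded_matrix_row_summable[OF K that] .
  have "(\<Sum>\<^sub>\<infinity>y\<in>S. K x y * (c * f y)) = c * (\<Sum>\<^sub>\<infinity>y\<in>S. K x y * f y)" if "x \<in> S" for x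
    using infsum_cmult_right[OF sum[OF that f], of c] by (simp add: mult.left_commute)
  then show "matrix_operator S K (\<lambda>x. c * f x) = (\<lambda>x. c * matrix_operator S K f x)"
    by (simp add: matrix_operator_def fun_eq_iff)
  assume g: "g \<in> ell2 S"
  have "(\<Sum>\<^sub>\<infinity>y\<in>S. K x y * (f y + g y)) = (\<Sum>\<^sub>\<infinity>y\<in>S. K x y * f y) + (\<Sum>\<^sub>\<infinity>y\<in>S. K x y * g y)"
    if "x \<in> S" for x
    using infsum_add[OF sum[OF that f] sum[OF that g]] by (simp add: distrib_left)
  then show "matrix_operator S K (\<lambda>x. f x + g x) = (\<lambda>x. matrix_operator S K f x + matrix_operator S K g x)"
    by (simp add: matrix_operator_def fun_eq_iff)
qed

lemma matrix_operator_delta: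
  "y \<in> S \<Longrightarrow> matrix_operator S K (delta y) = (\<lambda>x. if x \<in> S then K x y else 0)"
  by (auto simp: matrix_operator_def infsum_mult_delta fun_eq_iff)

text \<open>No absolute convergence is at hand to interchange the two sums. Instead, at a fixed
  coordinate x both sides are bounded linear functionals of h, and \<open>LK\<close> says that they
  agree on the standard basis.\<close>

lemma matrix_operator_left_inverse:
  assumes K: "bounded_matrix S C K" "0 \<le> C" and L: "bounded_matrix S D L" "0 \<le> D"
    and LK: "\<And>x y. x \<in> S \<Longrightarrow> y \<in> S \<Longrightarrow> (\<Sum>\<^sub>\<infinity>z\<in>S. L x z * K z y) = (if x = y then 1 else 0)"
    and h: "h \<in> ell2 S"
  shows "matrix_operator S L (matrix_operator S K h) = h"
proof
  fix x
  let ?T = "matrix_operator S K"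
  show "matrix_operator S L (?T h) x = h x"
  proof (cases "x \<in> S")
    case x: True
    \<comment> \<open>Row x of L, conjugated so that pairing with \<open>m\<close> computes the
      x-coordinate of the image under L. It is square-summable as a column of the adjoint.\<close>
    define m where "m = (\<lambda>z. if z \<in> S then cnj (L x z) else 0)"
    have m: "m \<in> ell2 S"
      unfolding m_def using bounded_matrix_column[OF bounded_matrix_adjoint[OF L(1)] L(2) x] by simp
    define \<Phi> where "\<Phi> h = ell2_inner S (?T h) m + (-1) * h x" for h
    have T: "?T f \<in> ell2 S" if "f \<in> ell2 S" for f
      using matrix_operator_ell2(1)[OF K that] .
    have inner: "ell2_inner S f m = (\<Sum>\<^sub>\<infinity>z\<in>S. L x z * f z)" for f
      unfolding ell2_inner_def m_def by (intro infsum_cong) auto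
    have bounded: "bounded_operator S ?T" by (rule matrix_operator_bounded_operator[OF K])
    have "\<Phi> h = 0"
    proof (rule bounded_functional_eq_0[where \<Phi> = \<Phi> and h = h and S = S and C = "C * ell2_norm S m + ell2_norm S (delta x)"])
      fix f g :: "'a \<Rightarrow> complex" and c :: complex
      assume f: "f \<in> ell2 S"
      show "\<Phi> (\<lambda>x. c * f x) = c * \<Phi> f"
        using bounded f ell2_inner_scale_left[OF T[OF f] m]
        unfolding \<Phi>_def bounded_operator_def by (simp add: algebra_simps)
      have "cmod (ell2_inner S (?T f) m) \<le> C * ell2_norm S f * ell2_norm S m"
        using ell2_inner_Cauchy_Schwarz[OF T[OF f] m] matrix_operator_ell2(2)[OF K f]
        by (meson ell2_norm_nonneg mult_right_mono order_trans)
      \<comment> \<open>Evaluation at x is bounded because it is the inner product with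
        \<open>delta x\<close>.\<close>
      moreover have "cmod (f x) \<le> ell2_norm S f * ell2_norm S (delta x)"
        using ell2_inner_Cauchy_Schwarz[OF f ell2_delta[OF x]] ell2_inner_delta_right[OF x] by metis
      ultimately show "cmod (\<Phi> f) \<le> (C * ell2_norm S m + ell2_norm S (delta x)) * ell2_norm S f"
        using norm_triangle_ineq[of "ell2_inner S (?T f) m" "(-1) * f x"]
        unfolding \<Phi>_def by (simp add: algebra_simps)
      assume g: "g \<in> ell2 S"
      show "\<Phi> (\<lambda>x. f x + g x) = \<Phi> f + \<Phi> g"
        using bounded f g ell2_inner_add_left[OF T[OF f] T[OF g] m]
        unfolding \<Phi>_def bounded_operator_def by (simp add: algebra_simps)
    next
      fix y assume y: "y \<in> S"
      have "ell2_inner S (?T (delta y)) m = (\<Sum>\<^sub>\<infinity>z\<in>S. L x z * K z y)"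
        unfolding inner matrix_operator_delta[OF y] by (intro infsum_cong) auto
      then show "\<Phi> (delta y) = 0"
        using LK[OF x y] by (simp add: \<Phi>_def delta_def)
    qed (rule h)
    then show ?thesis
      using x by (simp add: \<Phi>_def inner matrix_operator_def[of S L])
  qed (use h in \<open>simp add: matrix_operator_def ell2_outside\<close>)
qed

text \<open>The operator of K carries the standard basis to the columns of K, and its inverse is the
  operator of the adjoint of M: \<open>MK\<close> gives injectivity and \<open>KM\<close>
  surjectivity.\<close>

lemma riesz_basis_matrix_columns:
  assumes K: "bounded_matrix S C K" "0 \<le> C" and M: "bounded_matrix S D M" "0 \<le> D"
    and MK: "\<And>x y. x \<in> S \<Longrightarrow> y \<in> S \<Longrightarrow> (\<Sum>\<^sub>\<infinity>z\<in>S. cnj (M z x) * K z y) = (if x = y then 1 else 0)"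
    and KM: "\<And>x y. x \<in> S \<Longrightarrow> y \<in> S \<Longrightarrow> (\<Sum>\<^sub>\<infinity>z\<in>S. K x z * cnj (M y z)) = (if x = y then 1 else 0)"
  shows "riesz_basis S S (\<lambda>y x. if x \<in> S then K x y else 0)"
  unfolding riesz_basis_def
proof (intro exI[of _ delta] exI[of _ "matrix_operator S K"] conjI ballI)
  let ?L = "\<lambda>x y. cnj (M y x)"
  have L: "bounded_matrix S D ?L" by (rule bounded_matrix_adjoint[OF M(1)])
  show "bij_betw (matrix_operator S K) (ell2 S) (ell2 S)"
  proof (rule bij_betw_byWitness[where f' = "matrix_operator S ?L"])
    show "\<forall>h\<in>ell2 S. matrix_operator S ?L (matrix_operator S K h) = h"
      using matrix_operator_left_inverse[OF K L M(2) MK] by blast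
    show "\<forall>h\<in>ell2 S. matrix_operator S K (matrix_operator S ?L h) = h"
      using matrix_operator_left_inverse[OF L M(2) K KM] by blast
  qed (use matrix_operator_ell2(1)[OF K] matrix_operator_ell2(1)[OF L M(2)] in auto)
qed (auto simp: delta_orthonormal_basis matrix_operator_bounded_operator[OF K] matrix_operator_delta)

section \<open>Characters separate points\<close>

locale two_comm_groups = N: comm_group N + C: comm_group C
  for N :: "('n, 'c) monoid_scheme" (structure) and C :: "('m, 'd) monoid_scheme" (structure)
begin

text \<open>The graph of a homomorphism from a subgroup of \<open>N\<close> to \<open>C\<close>.\<close>

definition partial_hom :: "('n \<times> 'm) set \<Rightarrow> bool" where
  "partial_hom R \<longleftrightarrow> R \<subseteq> carrier N \<times> carrier C \<and> (\<one>\<^bsub>N\<^esub>, \<one>\<^bsub>C\<^esub>) \<in> R \<and>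
    (\<forall>a u b v. (a, u) \<in> R \<longrightarrow> (b, v) \<in> R \<longrightarrow> (a \<otimes>\<^bsub>N\<^esub> b, u \<otimes>\<^bsub>C\<^esub> v) \<in> R) \<and>
    (\<forall>a u. (a, u) \<in> R \<longrightarrow> (inv\<^bsub>N\<^esub> a, inv\<^bsub>C\<^esub> u) \<in> R) \<and>
    (\<forall>u. (\<one>\<^bsub>N\<^esub>, u) \<in> R \<longrightarrow> u = \<one>\<^bsub>C\<^esub>)"

lemma partial_homD:
  assumes "partial_hom R"
  shows "(a, u) \<in> R \<Longrightarrow> a \<in> carrier N" "(a, u) \<in> R \<Longrightarrow> u \<in> carrier C"
    "(\<one>\<^bsub>N\<^esub>, \<one>\<^bsub>C\<^esub>) \<in> R"
    "(a, u) \<in> R \<Longrightarrow> (b, v) \<in> R \<Longrightarrow> (a \<otimes>\<^bsub>N\<^esub> b, u \<otimes>\<^bsub>C\<^esub> v) \<in> R"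
    "(a, u) \<in> R \<Longrightarrow> (inv\<^bsub>N\<^esub> a, inv\<^bsub>C\<^esub> u) \<in> R"
    "(\<one>\<^bsub>N\<^esub>, u) \<in> R \<Longrightarrow> u = \<one>\<^bsub>C\<^esub>"
  using assms unfolding partial_hom_def by auto

text \<open>The quotient of two values at the same point is a value at the identity, hence
  trivial.\<close>

lemma partial_hom_unique:
  assumes R: "partial_hom R" and "(a, u) \<in> R" "(a, v) \<in> R"
  shows "u = v"
proof -
  note D = partial_homD[OF R]
  have "(a \<otimes>\<^bsub>N\<^esub> inv\<^bsub>N\<^esub> a, u \<otimes>\<^bsub>C\<^esub> inv\<^bsub>C\<^esub> v) \<in> R"
    by (intro D(4) D(5) assms)
  then have "u \<otimes>\<^bsub>C\<^esub> inv\<^bsub>C\<^esub> v = \<one>\<^bsub>C\<^esub>"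
    using D(1)[OF assms(2)] D(6) by simp
  then show ?thesis
    using D(2)[OF assms(2)] D(2)[OF assms(3)] by (metis C.inv_closed C.inv_equality C.inv_inv)
qed

lemma partial_hom_pow:
  assumes R: "partial_hom R" and "(a, u) \<in> R"
  shows "(a [^]\<^bsub>N\<^esub> (j::int), u [^]\<^bsub>C\<^esub> j) \<in> R"
proof -
  note D = partial_homD[OF R]
  have nat: "(a [^]\<^bsub>N\<^esub> (k::nat), u [^]\<^bsub>C\<^esub> k) \<in> R" for k
    by (induction k) (use assms in \<open>auto intro: D(3,4)\<close>)
  then show ?thesis
    by (cases "j < 0") (simp_all only: int_pow_def2[of N] int_pow_def2[of C] D(5) nat if_True if_False)
qed

text \<open>The domain grows to the subgroup generated by it and x, with x sent to z.
  \<open>compat\<close> makes z agree with R on the powers of x already in the domain, and this is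
  what keeps the value at the identity unique.\<close>

lemma partial_hom_extend:
  assumes R: "partial_hom R" and x: "x \<in> carrier N" and z: "z \<in> carrier C"
    and compat: "\<And>(j::int) w. (x [^]\<^bsub>N\<^esub> j, w) \<in> R \<Longrightarrow> z [^]\<^bsub>C\<^esub> j = w"
  shows "\<exists>R'. partial_hom R' \<and> R \<subseteq> R' \<and> (x, z) \<in> R'"
proof (intro exI conjI)
  note D = partial_homD[OF R]
  let ?R' = "{(a \<otimes>\<^bsub>N\<^esub> x [^]\<^bsub>N\<^esub> j, u \<otimes>\<^bsub>C\<^esub> z [^]\<^bsub>C\<^esub> j) | a u (j::int). (a, u) \<in> R}"
  show "R \<subseteq> ?R'"
  proof
    fix p assume p: "p \<in> R"
    obtain a u where [simp]: "p = (a, u)" by fastforce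
    show "p \<in> ?R'"
      using p D(1,2)[of a u] by (auto intro!: exI[of _ a] exI[of _ u] exI[of _ "0::int"])
  qed
  show "(x, z) \<in> ?R'"
    using D(3) x z by (auto intro!: exI[of _ "\<one>\<^bsub>N\<^esub>"] exI[of _ "\<one>\<^bsub>C\<^esub>"] exI[of _ "1::int"])
  show "partial_hom ?R'"
    unfolding partial_hom_def
  proof (intro conjI allI impI)
    show "?R' \<subseteq> carrier N \<times> carrier C" using D(1,2) x z by auto
    show "(\<one>\<^bsub>N\<^esub>, \<one>\<^bsub>C\<^esub>) \<in> ?R'" using \<open>R \<subseteq> ?R'\<close> D(3) by blast
  next
    fix a u b v assume "(a, u) \<in> ?R'" "(b, v) \<in> ?R'"
    then obtain a' u' and i :: int and b' v' and j :: int where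
      *: "(a', u') \<in> R" "a = a' \<otimes>\<^bsub>N\<^esub> x [^]\<^bsub>N\<^esub> i" "u = u' \<otimes>\<^bsub>C\<^esub> z [^]\<^bsub>C\<^esub> i"
         "(b', v') \<in> R" "b = b' \<otimes>\<^bsub>N\<^esub> x [^]\<^bsub>N\<^esub> j" "v = v' \<otimes>\<^bsub>C\<^esub> z [^]\<^bsub>C\<^esub> j"
      by blast
    have "a \<otimes>\<^bsub>N\<^esub> b = (a' \<otimes>\<^bsub>N\<^esub> b') \<otimes>\<^bsub>N\<^esub> x [^]\<^bsub>N\<^esub> (i + j)"
      using * D(1) x by (simp add: N.int_pow_mult N.m_ac)
    moreover have "u \<otimes>\<^bsub>C\<^esub> v = (u' \<otimes>\<^bsub>C\<^esub> v') \<otimes>\<^bsub>C\<^esub> z [^]\<^bsub>C\<^esub> (i + j)"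
      using * D(2) z by (simp add: C.int_pow_mult C.m_ac)
    ultimately show "(a \<otimes>\<^bsub>N\<^esub> b, u \<otimes>\<^bsub>C\<^esub> v) \<in> ?R'" using D(4) * by blast
  next
    fix a u assume "(a, u) \<in> ?R'"
    then obtain a' u' and i :: int where
      *: "(a', u') \<in> R" "a = a' \<otimes>\<^bsub>N\<^esub> x [^]\<^bsub>N\<^esub> i" "u = u' \<otimes>\<^bsub>C\<^esub> z [^]\<^bsub>C\<^esub> i"
      by blast
    have "inv\<^bsub>N\<^esub> a = inv\<^bsub>N\<^esub> a' \<otimes>\<^bsub>N\<^esub> x [^]\<^bsub>N\<^esub> (- i)"
      using * D(1) x by (simp add: N.int_pow_neg N.inv_mult)
    moreover have "inv\<^bsub>C\<^esub> u = inv\<^bsub>C\<^esub> u' \<otimes>\<^bsub>C\<^esub> z [^]\<^bsub>C\<^esub> (- i)"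
      using * D(2) z by (simp add: C.int_pow_neg C.inv_mult)
    ultimately show "(inv\<^bsub>N\<^esub> a, inv\<^bsub>C\<^esub> u) \<in> ?R'" using D(5) * by blast
  next
    fix u assume "(\<one>\<^bsub>N\<^esub>, u) \<in> ?R'"
    then obtain a' u' and i :: int where
      *: "(a', u') \<in> R" "\<one>\<^bsub>N\<^esub> = a' \<otimes>\<^bsub>N\<^esub> x [^]\<^bsub>N\<^esub> i" "u = u' \<otimes>\<^bsub>C\<^esub> z [^]\<^bsub>C\<^esub> i"
      by blast
    \<comment> \<open>The power x^(-i) lies in the old domain with value \<open>u'\<close>, so
      \<open>compat\<close> applies with exponent -i.\<close>
    have "a' = x [^]\<^bsub>N\<^esub> (- i)"
      using * D(1) x by (metis N.int_pow_closed N.int_pow_neg N.inv_equality)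
    then have "u' = inv\<^bsub>C\<^esub> (z [^]\<^bsub>C\<^esub> i)"
      using * compat z by (metis C.int_pow_neg)
    then show "u = \<one>\<^bsub>C\<^esub>" using * z by simp
  qed
qed

text \<open>The exponents j with x^j in the domain form a subgroup of the integers. If it is
  trivial, the identity of C serves as z. Otherwise it is generated by some k > 0, and z is a k-th
  root of the value at x^k, which divisibility supplies.\<close>

lemma partial_hom_compatible_value:
  assumes R: "partial_hom R" and x: "x \<in> carrier N"
    and div: "\<And>w (k::nat). w \<in> carrier C \<Longrightarrow> k > 0 \<Longrightarrow> \<exists>z\<in>carrier C. z [^]\<^bsub>C\<^esub> k = w"
  shows "\<exists>z\<in>carrier C. \<forall>(j::int) w. (x [^]\<^bsub>N\<^esub> j, w) \<in> R \<longrightarrow> z [^]\<^bsub>C\<^esub> j = w"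
proof -
  note D = partial_homD[OF R]
  define P where "P k \<longleftrightarrow> k > 0 \<and> (\<exists>w. (x [^]\<^bsub>N\<^esub> (int k), w) \<in> R)" for k
  have J: "P (nat j)" if "(x [^]\<^bsub>N\<^esub> j, w) \<in> R" "j > 0" for j w
    using that unfolding P_def by auto
  show ?thesis
  proof (cases "\<exists>k. P k")
    case False
    have "\<one>\<^bsub>C\<^esub> [^]\<^bsub>C\<^esub> j = w" if jw: "(x [^]\<^bsub>N\<^esub> j, w) \<in> R" for j :: int and w
    proof -
      have "(x [^]\<^bsub>N\<^esub> (- j), inv\<^bsub>C\<^esub> w) \<in> R"
        using D(5)[OF jw] x by (simp add: N.int_pow_neg)
      then have "\<not> j > 0" "\<not> - j > 0" using J jw False by blast+
      then have "j = 0" by simp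
      then show ?thesis using jw D(6) by simp
    qed
    then show ?thesis by blast
  next
    case True
    define k where "k = (LEAST k. P k)"
    have "P k" unfolding k_def using True by (metis LeastI)
    then obtain w0 where k: "k > 0" "(x [^]\<^bsub>N\<^esub> (int k), w0) \<in> R" unfolding P_def by blast
    obtain z where z: "z \<in> carrier C" "z [^]\<^bsub>C\<^esub> k = w0" using div k D(2) by blast
    have "z [^]\<^bsub>C\<^esub> j = w" if jw: "(x [^]\<^bsub>N\<^esub> j, w) \<in> R" for j :: int and w
    proof -
      \<comment> \<open>Division with remainder: r is again an exponent of this kind, so the
        minimality of k forces r = 0.\<close>
      define q where "q = j div int k"
      define r where "r = j mod int k"
      have j: "j = int k * q + r" by (simp add: q_def r_def)
      have kq: "(x [^]\<^bsub>N\<^esub> (int k * q), z [^]\<^bsub>C\<^esub> (int k * q)) \<in> R"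
        using partial_hom_pow[OF R k(2), of q] z(2)
        by (simp only: N.int_pow_pow[OF x] C.int_pow_pow[OF z(1), symmetric] int_pow_int[of C z])
      have "x [^]\<^bsub>N\<^esub> r = x [^]\<^bsub>N\<^esub> j \<otimes>\<^bsub>N\<^esub> inv\<^bsub>N\<^esub> (x [^]\<^bsub>N\<^esub> (int k * q))"
        using N.int_pow_diff[OF x, of j "int k * q"] j by simp
      then have "(x [^]\<^bsub>N\<^esub> r, w \<otimes>\<^bsub>C\<^esub> inv\<^bsub>C\<^esub> (z [^]\<^bsub>C\<^esub> (int k * q))) \<in> R"
        using D(4)[OF jw D(5)[OF kq]] by simp
      moreover have "0 \<le> r" "r < int k" using k by (auto simp: r_def)
      ultimately have "r = 0"
        using J[of r] Least_le[of P "nat r"] unfolding k_def[symmetric] by fastforce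
      then show ?thesis using partial_hom_unique[OF R jw] kq j by simp
    qed
    then show ?thesis using z by blast
  qed
qed

text \<open>A divisible abelian group is injective. \<open>compat\<close> makes the assignment of z
  to x a homomorphism on the cyclic subgroup of x, and by Zorn's lemma it has a maximal extension;
  this is total because a compatible value exists at every further element.\<close>

lemma hom_into_divisible_group:
  assumes x: "x \<in> carrier N" and z: "z \<in> carrier C"
    and compat: "\<And>j::int. x [^]\<^bsub>N\<^esub> j = \<one>\<^bsub>N\<^esub> \<Longrightarrow> z [^]\<^bsub>C\<^esub> j = \<one>\<^bsub>C\<^esub>"
    and div: "\<And>w (k::nat). w \<in> carrier C \<Longrightarrow> k > 0 \<Longrightarrow> \<exists>z\<in>carrier C. z [^]\<^bsub>C\<^esub> k = w"
  shows "\<exists>\<phi>. \<phi> \<in> hom N C \<and> \<phi> x = z"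
proof -
  have "partial_hom {(\<one>\<^bsub>N\<^esub>, \<one>\<^bsub>C\<^esub>)}" unfolding partial_hom_def by auto
  then obtain R0 where R0: "partial_hom R0" "(x, z) \<in> R0"
    using partial_hom_extend[OF _ x z] compat by blast
  \<comment> \<open>Only extensions of \<open>R0\<close> compete, so the maximal one still sends x
    to z.\<close>
  define \<A> where "\<A> = {R. partial_hom R \<and> R0 \<subseteq> R}"
  have "\<exists>M\<in>\<A>. \<forall>Y\<in>\<A>. M \<subseteq> Y \<longrightarrow> Y = M"
  proof (rule subset_Zorn_nonempty)
    show "\<A> \<noteq> {}" using R0 by (auto simp: \<A>_def)
    fix \<C> assume "\<C> \<noteq> {}" and chain: "subset.chain \<A> \<C>"
    then have ph: "partial_hom R" "R0 \<subseteq> R" if "R \<in> \<C>" for R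
      using that by (auto simp: subset_chain_def \<A>_def)
    \<comment> \<open>Two points of the union of a chain lie in a common member, which reduces
      closure under products to that member.\<close>
    have common: "\<exists>R\<in>\<C>. p \<in> R \<and> q \<in> R" if pq: "p \<in> \<Union>\<C>" "q \<in> \<Union>\<C>" for p q
    proof -
      obtain P Q where "P \<in> \<C>" "p \<in> P" "Q \<in> \<C>" "q \<in> Q" using pq by blast
      moreover from this have "P \<subseteq> Q \<or> Q \<subseteq> P" using chain by (simp add: subset_chain_def)
      ultimately show ?thesis by blast
    qed
    have "partial_hom (\<Union>\<C>)"
      unfolding partial_hom_def
    proof (intro conjI allI impI)
      show "\<Union>\<C> \<subseteq> carrier N \<times> carrier C" using ph(1) unfolding partial_hom_def by blast
      show "(\<one>\<^bsub>N\<^esub>, \<one>\<^bsub>C\<^esub>) \<in> \<Union>\<C>"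
        using ph(2) partial_homD(3)[OF R0(1)] \<open>\<C> \<noteq> {}\<close> by blast
    next
      fix a u b v assume "(a, u) \<in> \<Union>\<C>" "(b, v) \<in> \<Union>\<C>"
      then show "(a \<otimes>\<^bsub>N\<^esub> b, u \<otimes>\<^bsub>C\<^esub> v) \<in> \<Union>\<C>"
        using common[of "(a, u)" "(b, v)"] partial_homD(4)[OF ph(1)] by blast
    next
      fix a u assume "(a, u) \<in> \<Union>\<C>"
      then show "(inv\<^bsub>N\<^esub> a, inv\<^bsub>C\<^esub> u) \<in> \<Union>\<C>"
        using partial_homD(5)[OF ph(1)] by blast
    next
      fix u assume "(\<one>\<^bsub>N\<^esub>, u) \<in> \<Union>\<C>"
      then show "u = \<one>\<^bsub>C\<^esub>" using partial_homD(6)[OF ph(1)] by blast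
    qed
    then show "\<Union>\<C> \<in> \<A>" using ph(2) \<open>\<C> \<noteq> {}\<close> by (auto simp: \<A>_def)
  qed
  then obtain M where "M \<in> \<A>" and maximal: "\<forall>Y\<in>\<A>. M \<subseteq> Y \<longrightarrow> Y = M" by (elim bexE)
  then have M: "partial_hom M" "R0 \<subseteq> M" by (simp_all add: \<A>_def)
  have max: "Y = M" if "partial_hom Y" "M \<subseteq> Y" for Y
    using maximal that M(2) by (simp add: \<A>_def)
  have total: "\<exists>u. (n, u) \<in> M" if n: "n \<in> carrier N" for n
  proof -
    obtain v where v: "v \<in> carrier C" "\<forall>(j::int) w. (n [^]\<^bsub>N\<^esub> j, w) \<in> M \<longrightarrow> v [^]\<^bsub>C\<^esub> j = w"
      using partial_hom_compatible_value[OF M(1) n div] by blast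
    then obtain Y where "partial_hom Y" "M \<subseteq> Y" "(n, v) \<in> Y"
      using partial_hom_extend[OF M(1) n, of v] by blast
    then show ?thesis using max by blast
  qed
  define \<phi> where "\<phi> n = (THE u. (n, u) \<in> M)" for n
  have \<phi>: "\<phi> n = u" if "(n, u) \<in> M" for n u
    unfolding \<phi>_def using that partial_hom_unique[OF M(1)] by blast
  have "\<phi> \<in> hom N C"
  proof (rule homI)
    fix a assume "a \<in> carrier N"
    then show "\<phi> a \<in> carrier C" using total \<phi> partial_homD(2)[OF M(1)] by metis
  next
    fix a b assume "a \<in> carrier N" "b \<in> carrier N"
    then obtain u v where "(a, u) \<in> M" "(b, v) \<in> M" using total by blast
    then show "\<phi> (a \<otimes>\<^bsub>N\<^esub> b) = \<phi> a \<otimes>\<^bsub>C\<^esub> \<phi> b"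
      using \<phi> partial_homD(4)[OF M(1)] by metis
  qed
  moreover have "\<phi> x = z" using \<phi> R0 M by blast
  ultimately show ?thesis by blast
qed

end

section \<open>The circle group and nontrivial characters\<close>

lemma carrier_circle_group: "z \<in> carrier circle_group \<longleftrightarrow> cmod z = 1"
  by (simp add: circle_group_def)

lemma mult_circle_group: "z \<otimes>\<^bsub>circle_group\<^esub> w = z * w"
  and one_circle_group: "\<one>\<^bsub>circle_group\<^esub> = 1"
  by (simp_all add: circle_group_def)

lemma comm_group_circle_group: "comm_group circle_group"
proof (rule comm_groupI)
  fix z assume "z \<in> carrier circle_group"
  then show "\<exists>w\<in>carrier circle_group. w \<otimes>\<^bsub>circle_group\<^esub> z = \<one>\<^bsub>circle_group\<^esub>"
    by (intro bexI[of _ "inverse z"])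
      (auto simp: carrier_circle_group mult_circle_group one_circle_group norm_inverse
          intro!: left_inverse)
qed (auto simp: carrier_circle_group mult_circle_group one_circle_group norm_mult)

lemma nat_pow_circle_group: "z [^]\<^bsub>circle_group\<^esub> (k::nat) = z ^ k"
  by (induction k) (auto simp: mult_circle_group one_circle_group)

lemma circle_group_divisible:
  assumes "w \<in> carrier circle_group" "(k::nat) > 0"
  shows "\<exists>z\<in>carrier circle_group. z [^]\<^bsub>circle_group\<^esub> k = w"
proof
  have "cis (Arg w) = w"
    using assms cis_Arg[of w] by (cases "w = 0") (auto simp: carrier_circle_group sgn_eq)
  then show "cis (Arg w / k) [^]\<^bsub>circle_group\<^esub> k = w"
    using assms by (simp add: nat_pow_circle_group Complex.DeMoivre)
qed (simp add: carrier_circle_group)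

text \<open>It suffices to find z other than 1 on the circle that satisfies every relation x^j = 1;
  the extension theorem does the rest.\<close>

lemma hom_circle_nontrivial:
  assumes "comm_group N" "x \<in> carrier N" "x \<noteq> \<one>\<^bsub>N\<^esub>"
  shows "\<exists>\<phi>. \<phi> \<in> hom N circle_group \<and> \<phi> x \<noteq> 1"
proof -
  interpret two_comm_groups N circle_group
    using assms comm_group_circle_group by (simp add: two_comm_groups_def)
  define d where "d = N.ord x"
  have d: "d \<noteq> 1" using assms N.ord_eq_1 by (auto simp: d_def)
  \<comment> \<open>\<open>ord\<close> is 0 for an element of infinite order. Then only x^0 is
    trivial, and any z other than 1 would serve. For finite order d a primitive d-th root of unity
    is taken.\<close>
  define z where "z = (if d = 0 then - 1 else cis (2 * pi / d))"
  have z: "z \<in> carrier circle_group" by (simp add: z_def carrier_circle_group)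
  have "z \<noteq> 1"
  proof (cases "d = 0")
    case False
    then have "d \<ge> 2" using d by simp
    then have "0 < 2 * pi / d" "2 * pi / d < 2 * pi" by (auto simp: field_simps)
    have "cos (2 * pi / d) \<noteq> 1"
    proof
      assume "cos (2 * pi / d) = 1"
      then obtain n :: int where "2 * pi / d = real_of_int n * 2 * pi" using cos_one_2pi_int by blast
      then have "0 < real_of_int n" "real_of_int n < 1"
        using \<open>0 < 2 * pi / d\<close> \<open>2 * pi / d < 2 * pi\<close> by (simp_all add: zero_less_mult_iff)
      then show False by simp
    qed
    then show ?thesis using False by (auto simp: z_def complex_eq_iff)
  qed (simp add: z_def)
  have ord: "z [^]\<^bsub>circle_group\<^esub> d = 1"
    using Complex.DeMoivre[of "2 * pi / d" d] by (auto simp: z_def nat_pow_circle_group)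
  have "z [^]\<^bsub>circle_group\<^esub> j = \<one>\<^bsub>circle_group\<^esub>" if "x [^]\<^bsub>N\<^esub> j = \<one>\<^bsub>N\<^esub>" for j :: int
  proof -
    obtain i where i: "j = int d * i"
      using \<open>x [^]\<^bsub>N\<^esub> j = \<one>\<^bsub>N\<^esub>\<close> N.int_pow_eq_id[OF assms(2), of j] by (auto simp: d_def elim: dvdE)
    have "z [^]\<^bsub>circle_group\<^esub> j = (z [^]\<^bsub>circle_group\<^esub> d) [^]\<^bsub>circle_group\<^esub> i"
      by (simp only: i C.int_pow_pow[OF z, symmetric] int_pow_int)
    then show ?thesis using ord C.int_pow_one by (simp add: one_circle_group)
  qed
  then show ?thesis
    using hom_into_divisible_group[OF assms(2) z] circle_group_divisible \<open>z \<noteq> 1\<close> by blast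
qed

section \<open>Haar measure on the dual group\<close>

lemma carrier_dual_group:
  "\<xi> \<in> carrier (dual_group N) \<longleftrightarrow> \<xi> \<in> hom N circle_group \<and> \<xi> \<in> extensional (carrier N)"
  by (simp add: dual_group_def)

text \<open>Total mass 1 is the normalization for which the characters are orthonormal and the
  Fourier transform is isometric.\<close>

locale dual_haar = comm_group N for N :: "('n, 'c) monoid_scheme" (structure) +
  fixes \<mu> :: "('n \<Rightarrow> complex) measure"
  assumes haar: "haar_measure (dual_group N) (dual_topology N) \<mu>"
    and mass: "emeasure \<mu> (space \<mu>) = 1"
begin

lemma topspace_dual: "topspace (dual_topology N) = carrier (dual_group N)"
  and sets_\<mu>: "sets \<mu> = sets (sigma (topspace (dual_topology N)) {U. openin (dual_topology N) U})"
  using haar by (auto simp: haar_measure_def)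

lemma space_\<mu>: "space \<mu> = carrier (dual_group N)"
  using sets_eq_imp_space_eq[OF sets_\<mu>] by (simp add: topspace_dual space_measure_of_conv)

lemma openin_sets: "openin (dual_topology N) U \<Longrightarrow> U \<in> sets \<mu>"
  unfolding sets_\<mu> by (subst sets_measure_of) (auto dest: openin_subset)

sublocale finite_measure \<mu>
  by standard (simp add: mass)

lemma measure_space: "measure \<mu> (space \<mu>) = 1"
  by (simp add: measure_def mass)

lemma char_hom: "\<xi> \<in> space \<mu> \<Longrightarrow> \<xi> \<in> hom N circle_group"
  by (simp add: space_\<mu> carrier_dual_group)

lemma char_mult: "\<xi> \<in> space \<mu> \<Longrightarrow> n \<in> carrier N \<Longrightarrow> m \<in> carrier N \<Longrightarrow> \<xi> (n \<otimes> m) = \<xi> n * \<xi> m"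
  using hom_mult[OF char_hom] by (simp add: mult_circle_group)

lemma cmod_char: "\<xi> \<in> space \<mu> \<Longrightarrow> n \<in> carrier N \<Longrightarrow> cmod (\<xi> n) = 1"
  using hom_in_carrier[OF char_hom] by (simp flip: carrier_circle_group)

lemma char_one:
  assumes "\<xi> \<in> space \<mu>"
  shows "\<xi> \<one> = 1"
proof -
  have "\<xi> \<one> * \<xi> \<one> = \<xi> \<one>" "\<xi> \<one> \<noteq> 0"
    using char_mult[OF assms one_closed one_closed] cmod_char[OF assms one_closed] by auto
  then show ?thesis by simp
qed

lemma char_inv:
  assumes "\<xi> \<in> space \<mu>" "n \<in> carrier N"
  shows "\<xi> (inv n) = cnj (\<xi> n)"
proof -
  have "\<xi> (inv n) * \<xi> n = 1"
    using char_mult[of \<xi> "inv n" n] char_one[OF assms(1)] assms by simp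
  moreover have "\<xi> n * cnj (\<xi> n) = 1"
    using cmod_char[OF assms] by (simp add: complex_norm_square[symmetric])
  ultimately show ?thesis
    by (metis mult.assoc mult.commute mult.right_neutral)
qed

lemma continuous_map_char:
  assumes "n \<in> carrier N"
  shows "continuous_map (dual_topology N) euclidean (\<lambda>\<xi>. \<xi> n)"
  unfolding dual_topology_def
  by (intro continuous_map_from_subtopology continuous_map_product_projection assms)

lemma measurable_char [measurable]:
  assumes "n \<in> carrier N"
  shows "(\<lambda>\<xi>. \<xi> n) \<in> borel_measurable \<mu>"
proof (rule borel_measurableI)
  fix U :: "complex set" assume "open U"
  then have "openin (dual_topology N) {\<xi> \<in> topspace (dual_topology N). \<xi> n \<in> U}"
    using openin_continuous_map_preimage[OF continuous_map_char[OF assms]] by simp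
  moreover have "{\<xi> \<in> topspace (dual_topology N). \<xi> n \<in> U} = (\<lambda>\<xi>. \<xi> n) -` U \<inter> space \<mu>"
    by (auto simp: topspace_dual space_\<mu>)
  ultimately show "(\<lambda>\<xi>. \<xi> n) -` U \<inter> space \<mu> \<in> sets \<mu>"
    using openin_sets by metis
qed

lemma dual_mult: "\<xi> \<otimes>\<^bsub>dual_group N\<^esub> \<psi> = (\<lambda>n\<in>carrier N. \<xi> n * \<psi> n)"
  by (simp add: dual_group_def)

lemma dual_mult_closed:
  assumes "\<phi> \<in> space \<mu>" "\<xi> \<in> space \<mu>"
  shows "\<phi> \<otimes>\<^bsub>dual_group N\<^esub> \<xi> \<in> space \<mu>"
  using assms unfolding dual_mult space_\<mu> carrier_dual_group hom_def
  by (auto simp: carrier_circle_group mult_circle_group norm_mult Pi_iff)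

definition dual_inv :: "('n \<Rightarrow> complex) \<Rightarrow> 'n \<Rightarrow> complex" where
  "dual_inv \<xi> = (\<lambda>n\<in>carrier N. cnj (\<xi> n))"

lemma dual_inv_closed: "\<xi> \<in> space \<mu> \<Longrightarrow> dual_inv \<xi> \<in> space \<mu>"
  unfolding dual_inv_def space_\<mu> carrier_dual_group hom_def
  by (auto simp: carrier_circle_group mult_circle_group Pi_iff)

lemma dual_inv_cancel:
  assumes "\<phi> \<in> space \<mu>" "\<xi> \<in> space \<mu>"
  shows "dual_inv \<phi> \<otimes>\<^bsub>dual_group N\<^esub> (\<phi> \<otimes>\<^bsub>dual_group N\<^esub> \<xi>) = \<xi>"
    and "\<phi> \<otimes>\<^bsub>dual_group N\<^esub> (dual_inv \<phi> \<otimes>\<^bsub>dual_group N\<^esub> \<xi>) = \<xi>"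
proof -
  have "cnj (\<phi> n) * \<phi> n = 1" if "n \<in> carrier N" for n
    using cmod_char[OF assms(1) that] by (simp add: complex_norm_square[symmetric] mult.commute)
  moreover have "\<xi> \<in> extensional (carrier N)"
    using assms(2) by (simp add: space_\<mu> carrier_dual_group)
  ultimately show "dual_inv \<phi> \<otimes>\<^bsub>dual_group N\<^esub> (\<phi> \<otimes>\<^bsub>dual_group N\<^esub> \<xi>) = \<xi>"
    "\<phi> \<otimes>\<^bsub>dual_group N\<^esub> (dual_inv \<phi> \<otimes>\<^bsub>dual_group N\<^esub> \<xi>) = \<xi>"
    unfolding dual_mult dual_inv_def
    by (auto simp: fun_eq_iff restrict_def extensional_def mult.assoc[symmetric] mult.commute[of _ "cnj _"])
qed

lemma continuous_map_dual_mult: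
  assumes "\<phi> \<in> space \<mu>"
  shows "continuous_map (dual_topology N) (dual_topology N) (\<lambda>\<xi>. \<phi> \<otimes>\<^bsub>dual_group N\<^esub> \<xi>)"
proof -
  have "continuous_map (dual_topology N) (product_topology (\<lambda>_. euclidean) (carrier N))
      (\<lambda>\<xi>. \<phi> \<otimes>\<^bsub>dual_group N\<^esub> \<xi>)"
    unfolding continuous_map_componentwise dual_mult
  proof (intro conjI ballI)
    show "(\<lambda>\<xi>. \<lambda>n\<in>carrier N. \<phi> n * \<xi> n) ` topspace (dual_topology N) \<subseteq> extensional (carrier N)"
      by auto
    fix n assume n: "n \<in> carrier N"
    have "continuous_map euclidean euclidean (\<lambda>z. \<phi> n * z)"
      by (auto intro!: continuous_intros)
    from continuous_map_compose[OF continuous_map_char[OF n] this]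
    show "continuous_map (dual_topology N) euclidean (\<lambda>\<xi>. (\<lambda>n\<in>carrier N. \<phi> n * \<xi> n) n)"
      using n by (simp add: comp_def)
  qed
  then show ?thesis
    using dual_mult_closed[OF assms] topspace_dual space_\<mu> unfolding dual_topology_def
    by (subst continuous_map_in_subtopology) (auto simp: dual_topology_def)
qed

lemma measurable_dual_mult:
  assumes "\<phi> \<in> space \<mu>"
  shows "(\<lambda>\<xi>. \<phi> \<otimes>\<^bsub>dual_group N\<^esub> \<xi>) \<in> measurable \<mu> \<mu>"
proof -
  let ?T = "dual_topology N"
  have "(\<lambda>\<xi>. \<phi> \<otimes>\<^bsub>dual_group N\<^esub> \<xi>) \<in> measurable \<mu> (sigma (topspace ?T) {U. openin ?T U})"
  proof (rule measurable_measure_of)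
    fix U assume "U \<in> {U. openin ?T U}"
    then have "openin ?T {\<xi> \<in> topspace ?T. \<phi> \<otimes>\<^bsub>dual_group N\<^esub> \<xi> \<in> U}"
      using openin_continuous_map_preimage[OF continuous_map_dual_mult[OF assms]] by simp
    moreover have "{\<xi> \<in> topspace ?T. \<phi> \<otimes>\<^bsub>dual_group N\<^esub> \<xi> \<in> U} = (\<lambda>\<xi>. \<phi> \<otimes>\<^bsub>dual_group N\<^esub> \<xi>) -` U \<inter> space \<mu>"
      by (auto simp: topspace_dual space_\<mu>)
    ultimately show "(\<lambda>\<xi>. \<phi> \<otimes>\<^bsub>dual_group N\<^esub> \<xi>) -` U \<inter> space \<mu> \<in> sets \<mu>"
      using openin_sets by metis
  qed (use dual_mult_closed[OF assms] openin_subset[of ?T] in \<open>auto simp: topspace_dual space_\<mu>\<close>)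
  then show ?thesis
    by (simp only: measurable_cong_sets[OF refl sets_\<mu>])
qed

text \<open>Haar invariance is stated for images of sets while the push-forward measures preimages;
  the preimage under translation by \<phi> is the image under translation by
  \<open>dual_inv \<phi>\<close>.\<close>

lemma distr_dual_mult:
  assumes \<phi>: "\<phi> \<in> space \<mu>"
  shows "distr \<mu> \<mu> (\<lambda>\<xi>. \<phi> \<otimes>\<^bsub>dual_group N\<^esub> \<xi>) = \<mu>"
proof (rule measure_eqI)
  fix A assume "A \<in> sets (distr \<mu> \<mu> (\<lambda>\<xi>. \<phi> \<otimes>\<^bsub>dual_group N\<^esub> \<xi>))"
  then have A: "A \<in> sets \<mu>" "A \<subseteq> space \<mu>" using sets.sets_into_space by auto
  have "(\<lambda>\<xi>. \<phi> \<otimes>\<^bsub>dual_group N\<^esub> \<xi>) -` A \<inter> space \<mu> = (\<lambda>\<xi>. dual_inv \<phi> \<otimes>\<^bsub>dual_group N\<^esub> \<xi>) ` A"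
  proof (intro Set.set_eqI iffI)
    fix \<xi> assume "\<xi> \<in> (\<lambda>\<xi>. \<phi> \<otimes>\<^bsub>dual_group N\<^esub> \<xi>) -` A \<inter> space \<mu>"
    then show "\<xi> \<in> (\<lambda>\<xi>. dual_inv \<phi> \<otimes>\<^bsub>dual_group N\<^esub> \<xi>) ` A"
      using dual_inv_cancel(1)[OF \<phi>, of \<xi>] by (intro image_eqI[of _ _ "\<phi> \<otimes>\<^bsub>dual_group N\<^esub> \<xi>"]) auto
  next
    fix \<xi> assume "\<xi> \<in> (\<lambda>\<xi>. dual_inv \<phi> \<otimes>\<^bsub>dual_group N\<^esub> \<xi>) ` A"
    then obtain \<psi> where "\<psi> \<in> A" "\<xi> = dual_inv \<phi> \<otimes>\<^bsub>dual_group N\<^esub> \<psi>" by blast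
    then show "\<xi> \<in> (\<lambda>\<xi>. \<phi> \<otimes>\<^bsub>dual_group N\<^esub> \<xi>) -` A \<inter> space \<mu>"
      using A(2) dual_inv_cancel(2)[OF \<phi>, of \<psi>] dual_mult_closed[OF dual_inv_closed[OF \<phi>], of \<psi>] by auto
  qed
  then show "emeasure (distr \<mu> \<mu> (\<lambda>\<xi>. \<phi> \<otimes>\<^bsub>dual_group N\<^esub> \<xi>)) A = emeasure \<mu> A"
    using haar A dual_inv_closed[OF \<phi>] unfolding haar_measure_def
    by (simp add: emeasure_distr[OF measurable_dual_mult[OF \<phi>]] space_\<mu>)
qed simp

text \<open>Translation by a character that is not 1 at n leaves the integral unchanged and also
  multiplies it by the value of that character at n, so it vanishes.\<close>

lemma integral_char:
  assumes n: "n \<in> carrier N"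
  shows "(\<integral>\<xi>. \<xi> n \<partial>\<mu>) = (if n = \<one> then 1 else 0)"
proof (cases "n = \<one>")
  case True
  have "(\<integral>\<xi>. \<xi> n \<partial>\<mu>) = (\<integral>\<xi>. 1 \<partial>\<mu>)"
    by (intro Bochner_Integration.integral_cong) (auto simp: True char_one)
  then show ?thesis using True by (simp add: measure_space)
next
  case False
  obtain \<phi> where \<phi>: "\<phi> \<in> hom N circle_group" "\<phi> n \<noteq> 1"
    using hom_circle_nontrivial[OF _ n False] comm_group_axioms by blast
  \<comment> \<open>Elements of the dual group are extensional, hence the restriction to the
    carrier.\<close>
  define \<psi> where "\<psi> = restrict \<phi> (carrier N)"
  have "\<psi> \<in> hom N circle_group"
    using \<phi>(1) by (auto simp: \<psi>_def hom_def)
  then have \<psi>: "\<psi> \<in> space \<mu>" by (simp add: space_\<mu> carrier_dual_group \<psi>_def)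
  have "(\<integral>\<xi>. \<xi> n \<partial>\<mu>) = (\<integral>\<xi>. \<xi> n \<partial>distr \<mu> \<mu> (\<lambda>\<xi>. \<psi> \<otimes>\<^bsub>dual_group N\<^esub> \<xi>))"
    by (simp add: distr_dual_mult[OF \<psi>])
  also have "\<dots> = (\<integral>\<xi>. (\<psi> \<otimes>\<^bsub>dual_group N\<^esub> \<xi>) n \<partial>\<mu>)"
    by (intro integral_distr measurable_dual_mult \<psi> measurable_char n)
  also have "\<dots> = (\<integral>\<xi>. \<phi> n * \<xi> n \<partial>\<mu>)"
    using n by (simp add: dual_mult \<psi>_def)
  also have "\<dots> = \<phi> n * (\<integral>\<xi>. \<xi> n \<partial>\<mu>)" by simp
  finally have "(1 - \<phi> n) * (\<integral>\<xi>. \<xi> n \<partial>\<mu>) = 0" by (simp add: algebra_simps)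
  then show ?thesis using \<phi>(2) False by simp
qed

end

section \<open>Fourier transform of square-summable functions\<close>

definition norm2 :: "'a measure \<Rightarrow> ('a \<Rightarrow> complex) \<Rightarrow> real" where
  "norm2 M u = sqrt (\<integral>x. (cmod (u x))\<^sup>2 \<partial>M)"

lemma norm2_nonneg: "0 \<le> norm2 M u"
  by (simp add: norm2_def)

lemma norm2_sq: "(norm2 M u)\<^sup>2 = (\<integral>x. (cmod (u x))\<^sup>2 \<partial>M)"
  by (simp add: norm2_def)

lemma square_integrable_mult_integrable:
  assumes u: "square_integrable M u" and v: "square_integrable M v"
  shows "integrable M (\<lambda>x. u x * v x)"
proof (rule Bochner_Integration.integrable_bound)
  show "integrable M (\<lambda>x. (cmod (u x))\<^sup>2 + (cmod (v x))\<^sup>2)"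
    using u v by (simp add: square_integrable_def)
  show "(\<lambda>x. u x * v x) \<in> borel_measurable M"
    using u v by (auto simp: square_integrable_def)
  have "cmod (u x) * cmod (v x) \<le> (cmod (u x))\<^sup>2 + (cmod (v x))\<^sup>2" for x
    using sum_squares_bound[of "cmod (u x)" "cmod (v x)"]
      mult_nonneg_nonneg[OF norm_ge_zero norm_ge_zero, of "u x" "v x"]
    by linarith
  then show "AE x in M. norm (u x * v x) \<le> norm ((cmod (u x))\<^sup>2 + (cmod (v x))\<^sup>2)"
    by (simp add: norm_mult)
qed

text \<open>The modulus stands inside the integral: with v = 1 and total mass 1 this bounds the L^1
  norm by the L^2 norm, from which an almost everywhere convergent subsequence is later
  obtained.\<close>

lemma norm2_Cauchy_Schwarz:
  assumes u: "square_integrable M u" and v: "square_integrable M v"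
  shows "(\<integral>x. cmod (u x * v x) \<partial>M) \<le> norm2 M u * norm2 M v"
proof -
  have uv: "integrable M (\<lambda>x. cmod (u x * v x))"
    using square_integrable_mult_integrable[OF u v] by (rule integrable_norm)
  have [measurable]: "u \<in> borel_measurable M" "v \<in> borel_measurable M"
    using u v by (simp_all add: square_integrable_def)
  have nn: "(\<integral>\<^sup>+x. (ennreal (cmod (w x)))\<^sup>2 \<partial>M) = ennreal ((norm2 M w)\<^sup>2)"
    if "square_integrable M w" for w
    using that unfolding norm2_sq square_integrable_def
    by (subst nn_integral_eq_integral[symmetric]) (simp_all add: ennreal_power)
  have "ennreal ((\<integral>x. cmod (u x * v x) \<partial>M)\<^sup>2) = (\<integral>\<^sup>+x. cmod (u x * v x) \<partial>M)\<^sup>2"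
    using uv by (subst nn_integral_eq_integral) (simp_all add: ennreal_power)
  also have "\<dots> = (\<integral>\<^sup>+x. ennreal (cmod (u x)) * ennreal (cmod (v x)) \<partial>M)\<^sup>2"
    by (simp add: norm_mult ennreal_mult)
  also have "\<dots> \<le> (\<integral>\<^sup>+x. (ennreal (cmod (u x)))\<^sup>2 \<partial>M) * (\<integral>\<^sup>+x. (ennreal (cmod (v x)))\<^sup>2 \<partial>M)"
    by (rule Cauchy_Schwarz_nn_integral) measurable
  also have "\<dots> = ennreal ((norm2 M u * norm2 M v)\<^sup>2)"
    by (simp add: nn u v ennreal_mult power_mult_distrib)
  finally have "(\<integral>x. cmod (u x * v x) \<partial>M)\<^sup>2 \<le> (norm2 M u * norm2 M v)\<^sup>2"
    by (simp add: ennreal_le_iff)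
  then show ?thesis
    by (rule power2_le_imp_le) (simp add: norm2_nonneg)
qed

lemma norm2_Cauchy_Schwarz':
  assumes u: "square_integrable M u" and v: "square_integrable M v"
  shows "cmod (\<integral>x. u x * v x \<partial>M) \<le> norm2 M u * norm2 M v"
  by (rule order_trans[OF integral_norm_bound norm2_Cauchy_Schwarz[OF assms]])

lemma borel_measurable_cnj:
  "f \<in> borel_measurable M \<Longrightarrow> (\<lambda>x. cnj (f x)) \<in> borel_measurable M"
  by (rule borel_measurable_continuous_on[of cnj]) (intro continuous_intros)

lemma square_integrable_cnj: "square_integrable M u \<Longrightarrow> square_integrable M (\<lambda>x. cnj (u x))"
  by (auto simp: square_integrable_def borel_measurable_cnj)

lemma square_integrable_add:
  assumes u: "square_integrable M u" and v: "square_integrable M v"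
  shows "square_integrable M (\<lambda>x. u x + v x)"
  unfolding square_integrable_def
proof
  show meas: "(\<lambda>x. u x + v x) \<in> borel_measurable M"
    using u v by (auto simp: square_integrable_def)
  show "integrable M (\<lambda>x. (cmod (u x + v x))\<^sup>2)"
  proof (rule Bochner_Integration.integrable_bound)
    show "integrable M (\<lambda>x. 2 * (cmod (u x))\<^sup>2 + 2 * (cmod (v x))\<^sup>2)"
      using u v by (simp add: square_integrable_def)
    have "(cmod (u x + v x))\<^sup>2 \<le> 2 * (cmod (u x))\<^sup>2 + 2 * (cmod (v x))\<^sup>2" for x
    proof -
      have "(cmod (u x + v x))\<^sup>2 \<le> (cmod (u x) + cmod (v x))\<^sup>2"
        by (intro power_mono norm_triangle_ineq) auto
      also have "\<dots> \<le> 2 * (cmod (u x))\<^sup>2 + 2 * (cmod (v x))\<^sup>2"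
        using sum_squares_bound[of "cmod (u x)" "cmod (v x)"] by (simp add: power2_sum)
      finally show ?thesis .
    qed
    then show "AE x in M. norm ((cmod (u x + v x))\<^sup>2) \<le> norm (2 * (cmod (u x))\<^sup>2 + 2 * (cmod (v x))\<^sup>2)"
      by simp
  qed (use meas in simp)
qed

lemma square_integrable_bounded_mult:
  assumes u: "essentially_bounded M u" and v: "square_integrable M v"
  shows "square_integrable M (\<lambda>x. u x * v x)"
  unfolding square_integrable_def
proof
  obtain C where C: "AE x in M. cmod (u x) \<le> C" using u by (auto simp: essentially_bounded_def)
  show meas: "(\<lambda>x. u x * v x) \<in> borel_measurable M"
    using u v by (auto simp: square_integrable_def essentially_bounded_def)
  show "integrable M (\<lambda>x. (cmod (u x * v x))\<^sup>2)"
  proof (rule Bochner_Integration.integrable_bound)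
    show "integrable M (\<lambda>x. C\<^sup>2 * (cmod (v x))\<^sup>2)"
      using v by (simp add: square_integrable_def)
    show "AE x in M. norm ((cmod (u x * v x))\<^sup>2) \<le> norm (C\<^sup>2 * (cmod (v x))\<^sup>2)"
      using C by eventually_elim (auto simp: norm_mult power_mult_distrib intro!: mult_right_mono power_mono)
  qed (use meas in simp)
qed

lemma square_integrable_scale:
  "square_integrable M u \<Longrightarrow> square_integrable M (\<lambda>x. c * u x)"
  by (auto simp: square_integrable_def norm_mult power_mult_distrib)

lemma square_integrable_diff:
  assumes u: "square_integrable M u" and v: "square_integrable M v"
  shows "square_integrable M (\<lambda>x. u x - v x)"
  using square_integrable_add[OF u square_integrable_scale[OF v, of "-1"]] by simp

lemma essentially_bounded_cnj: "essentially_bounded M u \<Longrightarrow> essentially_bounded M (\<lambda>x. cnj (u x))"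
  by (auto simp: essentially_bounded_def borel_measurable_cnj)

lemma essentially_bounded_mult:
  assumes u: "essentially_bounded M u" and v: "essentially_bounded M v"
  shows "essentially_bounded M (\<lambda>x. u x * v x)"
proof -
  obtain C D where C: "AE x in M. cmod (u x) \<le> C" and D: "AE x in M. cmod (v x) \<le> D"
    using u v by (auto simp: essentially_bounded_def)
  have "AE x in M. cmod (u x * v x) \<le> C * D"
    using C D by eventually_elim (auto simp: norm_mult intro!: mult_mono intro: order_trans[OF norm_ge_zero])
  then show ?thesis using u v by (auto simp: essentially_bounded_def)
qed

lemma essentially_bounded_add:
  assumes u: "essentially_bounded M u" and v: "essentially_bounded M v"
  shows "essentially_bounded M (\<lambda>x. u x + v x)"
proof -
  obtain C D where C: "AE x in M. cmod (u x) \<le> C" and D: "AE x in M. cmod (v x) \<le> D"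
    using u v by (auto simp: essentially_bounded_def)
  have "AE x in M. cmod (u x + v x) \<le> C + D"
    using C D by eventually_elim (intro norm_triangle_mono)
  then show ?thesis using u v by (auto simp: essentially_bounded_def)
qed

lemma essentially_bounded_const: "essentially_bounded M (\<lambda>x. c)"
  by (auto simp: essentially_bounded_def intro!: exI[of _ "cmod c"])

lemma essentially_bounded_sum:
  "(\<And>i. i \<in> I \<Longrightarrow> essentially_bounded M (u i)) \<Longrightarrow> essentially_bounded M (\<lambda>x. \<Sum>i\<in>I. u i x)"
  by (induction I rule: infinite_finite_induct)
    (simp_all add: essentially_bounded_const essentially_bounded_add)

text \<open>By Cauchy-Schwarz, pairing with a fixed u is continuous in L^2. The filter is arbitrary
  because truncations run over the finite subsets of N rather than along a sequence.\<close>

lemma tendsto_integral_mult: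
  assumes p: "\<forall>\<^sub>F A in F. square_integrable M (p A)" and \<phi>: "square_integrable M \<phi>"
    and lim: "((\<lambda>A. \<integral>x. (cmod (p A x - \<phi> x))\<^sup>2 \<partial>M) \<longlongrightarrow> 0) F"
    and u: "square_integrable M u"
  shows "((\<lambda>A. \<integral>x. u x * p A x \<partial>M) \<longlongrightarrow> (\<integral>x. u x * \<phi> x \<partial>M)) F"
proof (rule LIM_zero_cancel, rule Lim_null_comparison)
  have "((\<lambda>A. norm2 M u * sqrt (\<integral>x. (cmod (p A x - \<phi> x))\<^sup>2 \<partial>M)) \<longlongrightarrow> norm2 M u * sqrt 0) F"
    by (intro tendsto_mult tendsto_real_sqrt lim tendsto_const)
  then show "((\<lambda>A. norm2 M u * norm2 M (\<lambda>x. p A x - \<phi> x)) \<longlongrightarrow> 0) F"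
    by (simp add: norm2_def)
  show "\<forall>\<^sub>F A in F. norm ((\<integral>x. u x * p A x \<partial>M) - (\<integral>x. u x * \<phi> x \<partial>M))
      \<le> norm2 M u * norm2 M (\<lambda>x. p A x - \<phi> x)"
    using p
  proof eventually_elim
    case (elim A)
    have "(\<integral>x. u x * p A x \<partial>M) - (\<integral>x. u x * \<phi> x \<partial>M) = (\<integral>x. u x * (p A x - \<phi> x) \<partial>M)"
      using square_integrable_mult_integrable[OF u elim] square_integrable_mult_integrable[OF u \<phi>]
      by (simp add: right_diff_distrib)
    then show ?case
      using norm2_Cauchy_Schwarz'[OF u square_integrable_diff[OF elim \<phi>]] by simp
  qed
qed

section \<open>Trigonometric polynomials, Fourier inversion and Parseval's identity\<close>

context dual_haar
begin

lemma square_integrable_essentially_bounded: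
  "essentially_bounded \<mu> u \<Longrightarrow> square_integrable \<mu> u"
  using square_integrable_bounded_mult[of \<mu> u "\<lambda>x. 1"] by (simp add: square_integrable_def)

lemma essentially_bounded_char: "n \<in> carrier N \<Longrightarrow> essentially_bounded \<mu> (\<lambda>\<xi>. \<xi> n)"
  unfolding essentially_bounded_def
  by (auto intro!: exI[of _ 1] AE_I2 simp: cmod_char measurable_char)

definition trig_poly :: "'n set \<Rightarrow> ('n \<Rightarrow> complex) \<Rightarrow> ('n \<Rightarrow> complex) \<Rightarrow> complex" where
  "trig_poly A a \<xi> = (\<Sum>n\<in>A. a n * \<xi> (inv n))"

lemma fourier_l1_truncation:
  assumes "finite A" "A \<subseteq> carrier N"
  shows "fourier_l1 N (\<lambda>n. if n \<in> A then a n else 0) = trig_poly A a"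
proof
  fix \<xi> :: "'n \<Rightarrow> complex"
  have "fourier_l1 N (\<lambda>n. if n \<in> A then a n else 0) \<xi> = (\<Sum>\<^sub>\<infinity>n\<in>A. a n * \<xi> (inv n))"
    unfolding fourier_l1_def using assms by (intro infsum_cong_neutral) auto
  then show "fourier_l1 N (\<lambda>n. if n \<in> A then a n else 0) \<xi> = trig_poly A a \<xi>"
    using assms by (simp add: trig_poly_def)
qed

lemma essentially_bounded_trig_poly:
  assumes "A \<subseteq> carrier N"
  shows "essentially_bounded \<mu> (trig_poly A a)"
  unfolding trig_poly_def using assms
  by (intro essentially_bounded_sum essentially_bounded_mult essentially_bounded_const
      essentially_bounded_char) auto

lemma square_integrable_trig_poly:
  "A \<subseteq> carrier N \<Longrightarrow> square_integrable \<mu> (trig_poly A a)"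
  by (intro square_integrable_essentially_bounded essentially_bounded_trig_poly)

lemma integral_mult_trig_poly:
  assumes "finite A" "A \<subseteq> carrier N" "square_integrable \<mu> u"
  shows "(\<integral>\<xi>. u \<xi> * trig_poly A a \<xi> \<partial>\<mu>) = (\<Sum>n\<in>A. a n * (\<integral>\<xi>. u \<xi> * \<xi> (inv n) \<partial>\<mu>))"
proof -
  have int: "integrable \<mu> (\<lambda>\<xi>. u \<xi> * \<xi> (inv n))" if "n \<in> A" for n
    using that assms(2)
    by (intro square_integrable_mult_integrable[OF assms(3)] square_integrable_essentially_bounded
        essentially_bounded_char) auto
  have "(\<integral>\<xi>. u \<xi> * trig_poly A a \<xi> \<partial>\<mu>) = (\<integral>\<xi>. (\<Sum>n\<in>A. a n * (u \<xi> * \<xi> (inv n))) \<partial>\<mu>)"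
    by (simp add: trig_poly_def sum_distrib_left mult.left_commute)
  also have "\<dots> = (\<Sum>n\<in>A. \<integral>\<xi>. a n * (u \<xi> * \<xi> (inv n)) \<partial>\<mu>)"
    using int by (intro Bochner_Integration.integral_sum) auto
  finally show ?thesis by simp
qed

lemma integral_char_orthogonal:
  assumes "n \<in> carrier N" "k \<in> carrier N"
  shows "(\<integral>\<xi>. \<xi> k * \<xi> (inv n) \<partial>\<mu>) = (if n = k then 1 else 0)"
proof -
  have "(\<integral>\<xi>. \<xi> k * \<xi> (inv n) \<partial>\<mu>) = (\<integral>\<xi>. \<xi> (k \<otimes> inv n) \<partial>\<mu>)"
    using assms by (intro Bochner_Integration.integral_cong) (auto simp: char_mult)
  moreover have "k \<otimes> inv n = \<one> \<longleftrightarrow> n = k"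
    using assms by (metis inv_closed inv_equality inv_inv r_inv)
  ultimately show ?thesis using assms by (simp add: integral_char)
qed

lemma integral_char_mult_trig_poly:
  assumes "finite A" "A \<subseteq> carrier N" "k \<in> carrier N"
  shows "(\<integral>\<xi>. \<xi> k * trig_poly A a \<xi> \<partial>\<mu>) = (if k \<in> A then a k else 0)"
proof -
  have "(\<Sum>n\<in>A. a n * (\<integral>\<xi>. \<xi> k * \<xi> (inv n) \<partial>\<mu>)) = (\<Sum>n\<in>A. if n = k then a n else 0)"
    using assms by (intro sum.cong) (auto simp: integral_char_orthogonal)
  then show ?thesis
    using assms by (subst integral_mult_trig_poly)
      (simp_all add: square_integrable_essentially_bounded essentially_bounded_char)
qed

text \<open>The squared modulus is written as the conjugate of the polynomial times the polynomial.
  Expanding the second factor leaves integrals of the first against characters, and orthogonality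
  reads off the conjugated coefficients.\<close>

lemma norm2_trig_poly:
  assumes "finite A" "A \<subseteq> carrier N"
  shows "(norm2 \<mu> (trig_poly A a))\<^sup>2 = (\<Sum>n\<in>A. (cmod (a n))\<^sup>2)"
proof -
  have sq: "square_integrable \<mu> (\<lambda>\<xi>. cnj (trig_poly A a \<xi>))"
    using assms by (intro square_integrable_cnj square_integrable_trig_poly)
  have "complex_of_real ((norm2 \<mu> (trig_poly A a))\<^sup>2) = (\<integral>\<xi>. complex_of_real ((cmod (trig_poly A a \<xi>))\<^sup>2) \<partial>\<mu>)"
    unfolding norm2_sq by (simp only: integral_complex_of_real)
  also have "\<dots> = (\<integral>\<xi>. cnj (trig_poly A a \<xi>) * trig_poly A a \<xi> \<partial>\<mu>)"
    by (simp only: complex_norm_square mult.commute)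
  also have "\<dots> = (\<Sum>n\<in>A. a n * (\<integral>\<xi>. cnj (trig_poly A a \<xi>) * \<xi> (inv n) \<partial>\<mu>))"
    by (rule integral_mult_trig_poly[OF assms sq])
  also have "\<dots> = (\<Sum>n\<in>A. complex_of_real ((cmod (a n))\<^sup>2))"
  proof (intro sum.cong refl)
    fix n assume n: "n \<in> A"
    have "(\<integral>\<xi>. cnj (trig_poly A a \<xi>) * \<xi> (inv n) \<partial>\<mu>) = (\<integral>\<xi>. cnj (\<xi> n * trig_poly A a \<xi>) \<partial>\<mu>)"
      using n assms by (intro Bochner_Integration.integral_cong) (auto simp: char_inv)
    also have "\<dots> = cnj (a n)"
      using n assms integral_char_mult_trig_poly[OF assms, of n a] by (subst Bochner_Integration.integral_cnj) auto
    finally show "a n * (\<integral>\<xi>. cnj (trig_poly A a \<xi>) * \<xi> (inv n) \<partial>\<mu>) = of_real ((cmod (a n))\<^sup>2)"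
      by (simp only: complex_norm_square)
  qed
  finally show ?thesis by (metis of_real_eq_iff of_real_sum)
qed


text \<open>A relation rather than a function: what is proved from it holds for every representative
  of the L^2 limit, in particular for the one that \<open>fourier_l2\<close> chooses.\<close>

definition l2_transform :: "('n \<Rightarrow> complex) \<Rightarrow> (('n \<Rightarrow> complex) \<Rightarrow> complex) \<Rightarrow> bool" where
  "l2_transform a \<phi> \<longleftrightarrow> square_integrable \<mu> \<phi> \<and>
    ((\<lambda>A. \<integral>\<xi>. (cmod (trig_poly A a \<xi> - \<phi> \<xi>))\<^sup>2 \<partial>\<mu>) \<longlongrightarrow> 0) (finite_subsets_at_top (carrier N))"

lemma l2_transform_square_integrable: "l2_transform a \<phi> \<Longrightarrow> square_integrable \<mu> \<phi>"
  by (simp add: l2_transform_def)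

text \<open>The partial sum over A is the pairing of u with the truncation to A, so L^2 convergence
  along finite subsets is unconditional summation of the series.\<close>

lemma l2_transform_has_sum:
  assumes \<phi>: "l2_transform a \<phi>" and u: "square_integrable \<mu> u"
  shows "((\<lambda>n. a n * (\<integral>\<xi>. u \<xi> * \<xi> (inv n) \<partial>\<mu>)) has_sum (\<integral>\<xi>. u \<xi> * \<phi> \<xi> \<partial>\<mu>)) (carrier N)"
proof -
  have "((\<lambda>A. \<integral>\<xi>. u \<xi> * trig_poly A a \<xi> \<partial>\<mu>) \<longlongrightarrow> (\<integral>\<xi>. u \<xi> * \<phi> \<xi> \<partial>\<mu>))
      (finite_subsets_at_top (carrier N))"
    using \<phi> unfolding l2_transform_def
    by (intro tendsto_integral_mult u eventually_finite_subsets_at_top_weakI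
        square_integrable_trig_poly) auto
  then show ?thesis
    unfolding has_sum_def
    by (rule Lim_transform_eventually)
      (intro eventually_finite_subsets_at_top_weakI integral_mult_trig_poly u)
qed

text \<open>With the character at k in the role of u, orthogonality leaves the single term n =
  k.\<close>

lemma l2_transform_inversion:
  assumes \<phi>: "l2_transform a \<phi>" and k: "k \<in> carrier N"
  shows "(\<integral>\<xi>. \<phi> \<xi> * \<xi> k \<partial>\<mu>) = a k"
proof -
  have "((\<lambda>n. a n * (\<integral>\<xi>. \<xi> k * \<xi> (inv n) \<partial>\<mu>)) has_sum (\<integral>\<xi>. \<xi> k * \<phi> \<xi> \<partial>\<mu>)) (carrier N)"
    by (intro l2_transform_has_sum \<phi> square_integrable_essentially_bounded essentially_bounded_char k)
  moreover have "((\<lambda>n. a n * (\<integral>\<xi>. \<xi> k * \<xi> (inv n) \<partial>\<mu>)) has_sum a k) (carrier N)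
      \<longleftrightarrow> ((\<lambda>n. a n) has_sum a k) {k}"
    using k by (intro has_sum_cong_neutral) (auto simp: integral_char_orthogonal)
  ultimately have "(\<integral>\<xi>. \<xi> k * \<phi> \<xi> \<partial>\<mu>) = a k"
    using has_sum_unique has_sum_finite[of "{k}" a] by fastforce
  then show ?thesis by (simp add: mult.commute)
qed

lemma square_integrable_mult_char:
  "square_integrable \<mu> u \<Longrightarrow> k \<in> carrier N \<Longrightarrow> square_integrable \<mu> (\<lambda>\<xi>. u \<xi> * \<xi> k)"
  using square_integrable_bounded_mult[OF essentially_bounded_char, of k u] by (simp add: mult.commute)

text \<open>Multiplication by the character at k translates the coefficients of \<phi>. The series
  for \<psi> is paired with the conjugate of this product, whose coefficients inversion
  identifies.\<close>

lemma l2_transform_Parseval: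
  assumes \<phi>: "l2_transform a \<phi>" and \<psi>: "l2_transform b \<psi>" and k: "k \<in> carrier N"
  shows "((\<lambda>n. a (n \<otimes> k) * cnj (b n)) has_sum (\<integral>\<xi>. \<phi> \<xi> * cnj (\<psi> \<xi>) * \<xi> k \<partial>\<mu>)) (carrier N)"
proof -
  have u: "square_integrable \<mu> (\<lambda>\<xi>. cnj (\<phi> \<xi> * \<xi> k))"
    by (intro square_integrable_cnj square_integrable_mult_char l2_transform_square_integrable[OF \<phi>] k)
  have "((\<lambda>n. cnj (b n * (\<integral>\<xi>. cnj (\<phi> \<xi> * \<xi> k) * \<xi> (inv n) \<partial>\<mu>)))
      has_sum cnj (\<integral>\<xi>. cnj (\<phi> \<xi> * \<xi> k) * \<psi> \<xi> \<partial>\<mu>)) (carrier N)"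
    using l2_transform_has_sum[OF \<psi> u] by (simp only: has_sum_cnj_iff)
  also have "cnj (\<integral>\<xi>. cnj (\<phi> \<xi> * \<xi> k) * \<psi> \<xi> \<partial>\<mu>) = (\<integral>\<xi>. \<phi> \<xi> * cnj (\<psi> \<xi>) * \<xi> k \<partial>\<mu>)"
    by (simp add: mult_ac flip: Bochner_Integration.integral_cnj)
  also have "((\<lambda>n. cnj (b n * (\<integral>\<xi>. cnj (\<phi> \<xi> * \<xi> k) * \<xi> (inv n) \<partial>\<mu>)))
      has_sum (\<integral>\<xi>. \<phi> \<xi> * cnj (\<psi> \<xi>) * \<xi> k \<partial>\<mu>)) (carrier N) \<longleftrightarrow> ?thesis"
  proof (rule has_sum_cong)
    fix n assume n: "n \<in> carrier N"
    have "cnj (\<integral>\<xi>. cnj (\<phi> \<xi> * \<xi> k) * \<xi> (inv n) \<partial>\<mu>) = (\<integral>\<xi>. \<phi> \<xi> * \<xi> (n \<otimes> k) \<partial>\<mu>)"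
      unfolding Bochner_Integration.integral_cnj[symmetric] using n k
      by (intro Bochner_Integration.integral_cong) (auto simp: char_inv char_mult)
    also have "\<dots> = a (n \<otimes> k)"
      using l2_transform_inversion[OF \<phi>] n k by simp
    finally show "cnj (b n * (\<integral>\<xi>. cnj (\<phi> \<xi> * \<xi> k) * \<xi> (inv n) \<partial>\<mu>)) = a (n \<otimes> k) * cnj (b n)"
      by (simp only: complex_cnj_mult mult.commute)
  qed
  finally show ?thesis .
qed

section \<open>Functions orthogonal to all characters\<close>

definition annihilates_chars :: "(('n \<Rightarrow> complex) \<Rightarrow> complex) \<Rightarrow> bool" where
  "annihilates_chars u \<longleftrightarrow> (\<forall>k\<in>carrier N. (\<integral>\<xi>. u \<xi> * \<xi> k \<partial>\<mu>) = 0)"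

lemma annihilates_chars_cnj:
  assumes "annihilates_chars u"
  shows "annihilates_chars (\<lambda>\<xi>. cnj (u \<xi>))"
  unfolding annihilates_chars_def
proof
  fix k assume k: "k \<in> carrier N"
  have "(\<integral>\<xi>. cnj (u \<xi>) * \<xi> k \<partial>\<mu>) = cnj (\<integral>\<xi>. u \<xi> * \<xi> (inv k) \<partial>\<mu>)"
    unfolding Bochner_Integration.integral_cnj[symmetric] using k
    by (intro Bochner_Integration.integral_cong) (auto simp: char_inv)
  then show "(\<integral>\<xi>. cnj (u \<xi>) * \<xi> k \<partial>\<mu>) = 0"
    using assms k by (simp add: annihilates_chars_def)
qed

text \<open>Integrating the Fourier series of \<phi> term by term against u times the character at k
  gives coefficients of u again, at \<open>k \<otimes> inv n\<close>, and all of them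
  vanish.\<close>

lemma annihilates_chars_mult:
  assumes u: "square_integrable \<mu> u" "annihilates_chars u" and \<phi>: "l2_transform a \<phi>"
  shows "annihilates_chars (\<lambda>\<xi>. u \<xi> * \<phi> \<xi>)"
  unfolding annihilates_chars_def
proof
  fix k assume k: "k \<in> carrier N"
  have "((\<lambda>n. a n * (\<integral>\<xi>. u \<xi> * \<xi> k * \<xi> (inv n) \<partial>\<mu>)) has_sum (\<integral>\<xi>. u \<xi> * \<xi> k * \<phi> \<xi> \<partial>\<mu>)) (carrier N)"
    by (intro l2_transform_has_sum[OF \<phi>] square_integrable_mult_char u k)
  also have "?this \<longleftrightarrow> ((\<lambda>n. 0) has_sum (\<integral>\<xi>. u \<xi> * \<xi> k * \<phi> \<xi> \<partial>\<mu>)) (carrier N)"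
  proof (rule has_sum_cong)
    fix n assume n: "n \<in> carrier N"
    have "(\<integral>\<xi>. u \<xi> * \<xi> k * \<xi> (inv n) \<partial>\<mu>) = (\<integral>\<xi>. u \<xi> * \<xi> (k \<otimes> inv n) \<partial>\<mu>)"
      using n k by (intro Bochner_Integration.integral_cong) (auto simp: char_mult)
    then show "a n * (\<integral>\<xi>. u \<xi> * \<xi> k * \<xi> (inv n) \<partial>\<mu>) = 0"
      using u n k by (simp add: annihilates_chars_def)
  qed
  finally have "(\<integral>\<xi>. u \<xi> * \<xi> k * \<phi> \<xi> \<partial>\<mu>) = 0"
    using has_sum_0_simp has_sum_unique by blast
  then show "(\<integral>\<xi>. u \<xi> * \<phi> \<xi> * \<xi> k \<partial>\<mu>) = 0" by (simp add: mult_ac)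
qed

lemma annihilates_chars_mult_cnj:
  assumes u: "square_integrable \<mu> u" "annihilates_chars u" and \<phi>: "l2_transform a \<phi>"
  shows "annihilates_chars (\<lambda>\<xi>. u \<xi> * cnj (\<phi> \<xi>))"
  using annihilates_chars_cnj[OF annihilates_chars_mult[OF square_integrable_cnj[OF u(1)]
      annihilates_chars_cnj[OF u(2)] \<phi>]] by simp

text \<open>Riesz-Fischer: truncations whose tails tend to zero are Cauchy in L^2, hence in L^1, so
  a subsequence converges almost everywhere. Fatou's lemma then shows that this pointwise limit is
  the L^2 limit over all finite subsets.\<close>

lemma ell2_has_l2_transform:
  assumes a: "a \<in> ell2 (carrier N)"
  shows "\<exists>\<phi>. l2_transform a \<phi>"
proof -
  let ?q = "\<lambda>n. (cmod (a n))\<^sup>2"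
  define E where "E = (\<Sum>\<^sub>\<infinity>n\<in>carrier N. ?q n)"
  have le_E: "sum ?q A \<le> E" if "finite A" "A \<subseteq> carrier N" for A
    unfolding E_def using that ell2_summable[OF a] by (intro finite_sum_le_infsum) auto
  have tail: "((\<lambda>A. E - sum ?q A) \<longlongrightarrow> 0) (finite_subsets_at_top (carrier N))"
    using tendsto_diff[OF tendsto_const[of E] infsum_tendsto[OF ell2_summable[OF a]]]
    by (simp add: E_def)
  \<comment> \<open>Coefficients cancel on the intersection, so only the symmetric difference of A
    and B counts; one half of it lies in the tail of A, the other in the tail of B.\<close>
  have diff: "(norm2 \<mu> (\<lambda>\<xi>. trig_poly A a \<xi> - trig_poly B a \<xi>))\<^sup>2 \<le> (E - sum ?q A) + (E - sum ?q B)"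
    if AB: "finite A" "A \<subseteq> carrier N" "finite B" "B \<subseteq> carrier N" for A B
  proof -
    define c where "c n = (if n \<in> A then a n else 0) - (if n \<in> B then a n else 0)" for n
    have "trig_poly A a \<xi> - trig_poly B a \<xi> = trig_poly (A \<union> B) c \<xi>" for \<xi>
    proof -
      have "trig_poly A a \<xi> = (\<Sum>n\<in>A \<union> B. (if n \<in> A then a n else 0) * \<xi> (inv n))"
        unfolding trig_poly_def using AB by (intro sum.mono_neutral_cong_left) auto
      moreover have "trig_poly B a \<xi> = (\<Sum>n\<in>A \<union> B. (if n \<in> B then a n else 0) * \<xi> (inv n))"
        unfolding trig_poly_def using AB by (intro sum.mono_neutral_cong_left) auto
      ultimately show ?thesis
        by (simp add: trig_poly_def c_def left_diff_distrib sum_subtractf)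
    qed
    then have "(norm2 \<mu> (\<lambda>\<xi>. trig_poly A a \<xi> - trig_poly B a \<xi>))\<^sup>2 = (\<Sum>n\<in>A \<union> B. (cmod (c n))\<^sup>2)"
      using norm2_trig_poly[of "A \<union> B" c] AB by simp
    also have "\<dots> = (\<Sum>n\<in>A \<union> B. (if n \<in> A then 0 else ?q n) + (if n \<in> B then 0 else ?q n))"
      by (intro sum.cong) (auto simp: c_def)
    also have "\<dots> = (\<Sum>n\<in>A \<union> B. if n \<in> A then 0 else ?q n) + (\<Sum>n\<in>A \<union> B. if n \<in> B then 0 else ?q n)"
      by (rule sum.distrib)
    also have "(\<Sum>n\<in>A \<union> B. if n \<in> A then 0 else ?q n) = sum ?q (A \<union> B) - sum ?q A"
      using AB sum.subset_diff[of A "A \<union> B" ?q] sum.subset_diff[of A "A \<union> B" "\<lambda>n. if n \<in> A then 0 else ?q n"]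
      by simp
    also have "(\<Sum>n\<in>A \<union> B. if n \<in> B then 0 else ?q n) = sum ?q (A \<union> B) - sum ?q B"
      using AB sum.subset_diff[of B "A \<union> B" ?q] sum.subset_diff[of B "A \<union> B" "\<lambda>n. if n \<in> B then 0 else ?q n"]
      by simp
    finally show ?thesis using le_E[of "A \<union> B"] AB by simp
  qed
  \<comment> \<open>The subsequence argument requires a sequence, so one finite set is picked for
    each tolerance 1/(i+1).\<close>
  have "\<exists>A. finite A \<and> A \<subseteq> carrier N \<and> E - sum ?q A < inverse (real (Suc i))" for i
    using order_tendstoD(2)[OF tail, of "inverse (real (Suc i))"]
    by (auto simp: eventually_finite_subsets_at_top)
  then obtain S where S: "\<And>i. finite (S i)" "\<And>i. S i \<subseteq> carrier N"
      "\<And>i. E - sum ?q (S i) < inverse (real (Suc i))"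
    by metis
  define s where "s i = trig_poly (S i) a" for i
  have s: "square_integrable \<mu> (s i)" for i
    unfolding s_def by (rule square_integrable_trig_poly[OF S(2)])
  have one: "square_integrable \<mu> (\<lambda>\<xi>. 1)"
    by (intro square_integrable_essentially_bounded essentially_bounded_const)
  have L2_L1: "(\<integral>\<xi>. cmod (v \<xi>) \<partial>\<mu>) \<le> norm2 \<mu> v" if "square_integrable \<mu> v" for v
    using norm2_Cauchy_Schwarz[OF that one] by (simp add: norm2_def[of _ "\<lambda>\<xi>. 1"] measure_space)
  have "\<exists>N0. \<forall>i\<ge>N0. \<forall>j\<ge>N0. (\<integral>\<xi>. cmod (s i \<xi> - s j \<xi>) \<partial>\<mu>) < e" if "e > 0" for e
  proof -
    obtain N0 where N0: "inverse (real (Suc N0)) < e\<^sup>2 / 2"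
      using reals_Archimedean[OF half_gt_zero[OF zero_less_power[OF \<open>e > 0\<close>]]] by blast
    have "(\<integral>\<xi>. cmod (s i \<xi> - s j \<xi>) \<partial>\<mu>) < e" if "i \<ge> N0" "j \<ge> N0" for i j
    proof -
      have *: "E - sum ?q (S k) < e\<^sup>2 / 2" if "k \<ge> N0" for k
      proof -
        have "inverse (real (Suc k)) \<le> inverse (real (Suc N0))" using that by (simp add: le_imp_inverse_le)
        then show ?thesis using S(3)[of k] N0 by linarith
      qed
      have "(norm2 \<mu> (\<lambda>\<xi>. s i \<xi> - s j \<xi>))\<^sup>2 < e\<^sup>2"
        using diff[OF S(1,2) S(1,2), of i j] *[OF \<open>i \<ge> N0\<close>] *[OF \<open>j \<ge> N0\<close>] unfolding s_def by linarith
      then have "norm2 \<mu> (\<lambda>\<xi>. s i \<xi> - s j \<xi>) < e"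
        using \<open>e > 0\<close> by (simp add: power2_less_imp_less)
      then show ?thesis using L2_L1[OF square_integrable_diff[OF s s], of i j] by linarith
    qed
    then show ?thesis by blast
  qed
  moreover have "integrable \<mu> (s i)" for i
    using square_integrable_mult_integrable[OF s one] by simp
  ultimately obtain r where r: "strict_mono r" "AE \<xi> in \<mu>. Cauchy (\<lambda>i. s (r i) \<xi>)"
    using cauchy_L1_AE_cauchy_subseq[of \<mu> s] by blast
  define \<phi> where "\<phi> \<xi> = lim (\<lambda>i. s (r i) \<xi>)" for \<xi>
  have s_meas [measurable]: "s i \<in> borel_measurable \<mu>" for i
    using s by (simp add: square_integrable_def)
  have \<phi>_meas [measurable]: "\<phi> \<in> borel_measurable \<mu>"
    unfolding \<phi>_def by (rule borel_measurable_lim_metric) simp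
  have \<phi>_lim: "AE \<xi> in \<mu>. (\<lambda>i. s (r i) \<xi>) \<longlonglongrightarrow> \<phi> \<xi>"
    using r(2) unfolding \<phi>_def by eventually_elim (simp add: Cauchy_convergent_iff convergent_LIMSEQ_iff)
  \<comment> \<open>Fatou along the subsequence: for every finite A, not only for the chosen sets,
    the squared distance from the truncation to \<phi> is at most the tail of A, since the tails of
    \<open>S (r i)\<close> vanish.\<close>
  have nn: "(\<integral>\<^sup>+\<xi>. ennreal ((cmod (trig_poly A a \<xi> - \<phi> \<xi>))\<^sup>2) \<partial>\<mu>) \<le> ennreal (E - sum ?q A)"
    if A: "finite A" "A \<subseteq> carrier N" for A
  proof -
    let ?p = "trig_poly A a"
    have p: "square_integrable \<mu> ?p" by (rule square_integrable_trig_poly[OF A(2)])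
    have [measurable]: "?p \<in> borel_measurable \<mu>" using p by (simp add: square_integrable_def)
    have "(\<integral>\<^sup>+\<xi>. ennreal ((cmod (?p \<xi> - \<phi> \<xi>))\<^sup>2) \<partial>\<mu>)
        = (\<integral>\<^sup>+\<xi>. liminf (\<lambda>i. ennreal ((cmod (?p \<xi> - s (r i) \<xi>))\<^sup>2)) \<partial>\<mu>)"
    proof (rule nn_integral_cong_AE)
      show "AE \<xi> in \<mu>. ennreal ((cmod (?p \<xi> - \<phi> \<xi>))\<^sup>2) = liminf (\<lambda>i. ennreal ((cmod (?p \<xi> - s (r i) \<xi>))\<^sup>2))"
        using \<phi>_lim
      proof eventually_elim
        case (elim \<xi>)
        have "(\<lambda>i. ennreal ((cmod (?p \<xi> - s (r i) \<xi>))\<^sup>2)) \<longlonglongrightarrow> ennreal ((cmod (?p \<xi> - \<phi> \<xi>))\<^sup>2)"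
          by (intro tendsto_ennrealI tendsto_power tendsto_norm tendsto_diff tendsto_const elim)
        from lim_imp_Liminf[OF sequentially_bot this] show ?case by (rule sym)
      qed
    qed
    also have "\<dots> \<le> liminf (\<lambda>i. \<integral>\<^sup>+\<xi>. ennreal ((cmod (?p \<xi> - s (r i) \<xi>))\<^sup>2) \<partial>\<mu>)"
      by (rule nn_integral_liminf) measurable
    also have "\<dots> \<le> liminf (\<lambda>i. ennreal ((E - sum ?q A) + inverse (real (Suc i))))"
    proof (intro Liminf_mono always_eventually allI)
      fix i
      have "(\<integral>\<^sup>+\<xi>. ennreal ((cmod (?p \<xi> - s (r i) \<xi>))\<^sup>2) \<partial>\<mu>) = ennreal ((norm2 \<mu> (\<lambda>\<xi>. ?p \<xi> - s (r i) \<xi>))\<^sup>2)"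
        using square_integrable_diff[OF p s] unfolding norm2_sq square_integrable_def
        by (intro nn_integral_eq_integral) auto
      also have "\<dots> \<le> ennreal ((E - sum ?q A) + inverse (real (Suc i)))"
      proof (rule ennreal_leI)
        have "i \<le> r i" using r(1) by (rule seq_suble)
        then have "inverse (real (Suc (r i))) \<le> inverse (real (Suc i))" by (simp add: le_imp_inverse_le)
        then show "(norm2 \<mu> (\<lambda>\<xi>. ?p \<xi> - s (r i) \<xi>))\<^sup>2 \<le> (E - sum ?q A) + inverse (real (Suc i))"
          using diff[OF A S(1,2), of "r i"] S(3)[of "r i"] unfolding s_def by linarith
      qed
      finally show "(\<integral>\<^sup>+\<xi>. ennreal ((cmod (?p \<xi> - s (r i) \<xi>))\<^sup>2) \<partial>\<mu>)
          \<le> ennreal ((E - sum ?q A) + inverse (real (Suc i)))" .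
    qed
    also have "\<dots> = ennreal (E - sum ?q A)"
    proof (rule lim_imp_Liminf)
      have "(\<lambda>i. (E - sum ?q A) + inverse (real (Suc i))) \<longlonglongrightarrow> (E - sum ?q A) + 0"
        by (intro tendsto_add tendsto_const LIMSEQ_inverse_real_of_nat)
      then show "(\<lambda>i. ennreal ((E - sum ?q A) + inverse (real (Suc i)))) \<longlonglongrightarrow> ennreal (E - sum ?q A)"
        by (intro tendsto_ennrealI) simp
    qed simp
    finally show ?thesis .
  qed
  have int: "integrable \<mu> (\<lambda>\<xi>. (cmod (trig_poly A a \<xi> - \<phi> \<xi>))\<^sup>2)"
    and le: "(\<integral>\<xi>. (cmod (trig_poly A a \<xi> - \<phi> \<xi>))\<^sup>2 \<partial>\<mu>) \<le> E - sum ?q A"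
    if A: "finite A" "A \<subseteq> carrier N" for A
  proof -
    have [measurable]: "trig_poly A a \<in> borel_measurable \<mu>"
      using square_integrable_trig_poly[OF A(2)] by (simp add: square_integrable_def)
    show int: "integrable \<mu> (\<lambda>\<xi>. (cmod (trig_poly A a \<xi> - \<phi> \<xi>))\<^sup>2)"
    proof (rule integrableI_bounded)
      show "(\<integral>\<^sup>+\<xi>. ennreal (norm ((cmod (trig_poly A a \<xi> - \<phi> \<xi>))\<^sup>2)) \<partial>\<mu>) < \<infinity>"
        using nn[OF A] by (simp add: le_less_trans[OF _ ennreal_less_top])
    qed simp
    have "ennreal (\<integral>\<xi>. (cmod (trig_poly A a \<xi> - \<phi> \<xi>))\<^sup>2 \<partial>\<mu>) \<le> ennreal (E - sum ?q A)"
      using nn[OF A] nn_integral_eq_integral[OF int] by simp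
    then show "(\<integral>\<xi>. (cmod (trig_poly A a \<xi> - \<phi> \<xi>))\<^sup>2 \<partial>\<mu>) \<le> E - sum ?q A"
      using le_E[OF A] by (simp add: ennreal_le_iff)
  qed
  have "l2_transform a \<phi>"
    unfolding l2_transform_def
  proof
    \<comment> \<open>The truncation to the empty set is 0, so this instance of \<open>int\<close>
      concerns \<phi> alone.\<close>
    show "square_integrable \<mu> \<phi>"
      using int[of "{}"] by (simp add: square_integrable_def trig_poly_def)
    show "((\<lambda>A. \<integral>\<xi>. (cmod (trig_poly A a \<xi> - \<phi> \<xi>))\<^sup>2 \<partial>\<mu>) \<longlongrightarrow> 0) (finite_subsets_at_top (carrier N))"
    proof (rule tendsto_sandwich[OF _ _ tendsto_const tail])
      show "\<forall>\<^sub>F A in finite_subsets_at_top (carrier N).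
          (\<integral>\<xi>. (cmod (trig_poly A a \<xi> - \<phi> \<xi>))\<^sup>2 \<partial>\<mu>) \<le> E - sum ?q A"
        by (intro eventually_finite_subsets_at_top_weakI le)
    qed simp
  qed
  then show ?thesis by blast
qed

text \<open>Existence of a transform allows the choice in \<open>fourier_l2\<close> to be resolved;
  along finite subsets, its truncations are the trigonometric polynomials of
  \<open>l2_transform\<close>.\<close>

lemma fourier_l2_transform:
  assumes "a \<in> ell2 (carrier N)"
  shows "l2_transform a (fourier_l2 N \<mu> a)"
proof -
  have "((\<lambda>A. \<integral>\<xi>. (cmod (fourier_l1 N (\<lambda>n. if n \<in> A then a n else 0) \<xi> - \<phi> \<xi>))\<^sup>2 \<partial>\<mu>) \<longlongrightarrow> 0)
      (finite_subsets_at_top (carrier N)) \<longleftrightarrow>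
    ((\<lambda>A. \<integral>\<xi>. (cmod (trig_poly A a \<xi> - \<phi> \<xi>))\<^sup>2 \<partial>\<mu>) \<longlongrightarrow> 0) (finite_subsets_at_top (carrier N))" for \<phi>
    by (intro tendsto_cong eventually_finite_subsets_at_top_weakI) (simp add: fourier_l1_truncation)
  then have "fourier_l2 N \<mu> a = (SOME \<phi>. l2_transform a \<phi>)"
    by (simp add: fourier_l2_def l2_transform_def)
  then show ?thesis
    using someI_ex[OF ell2_has_l2_transform[OF assms]] by simp
qed

end

section \<open>Finite matrices, slices of finite sums and bounded multipliers\<close>

text \<open>For finite square matrices over a field a one-sided inverse is two-sided; an enumeration
  of I transports this to functions of two indices.\<close>

lemma is_inverse_matrix_if_left_inverse:
  assumes I: "finite I"
    and AB: "\<And>i j. i \<in> I \<Longrightarrow> j \<in> I \<Longrightarrow> (\<Sum>k\<in>I. A i k * B k j) = (if i = j then 1 else 0)"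
  shows "is_inverse_matrix I A B"
proof -
  obtain e where e: "bij_betw e {0..<card I} I"
    using ex_bij_betw_nat_finite[OF I] by blast
  define n where "n = card I"
  have e: "bij_betw e {0..<n} I" using e by (simp add: n_def)
  define tomat :: "('a \<Rightarrow> 'a \<Rightarrow> complex) \<Rightarrow> complex mat"
    where "tomat C = Matrix.mat n n (\<lambda>(i, j). C (e i) (e j))" for C
  have carrier: "tomat C \<in> carrier_mat n n" for C by (simp add: tomat_def)
  have eI: "e i \<in> I" if "i < n" for i using bij_betwE[OF e] that by auto
  have eq: "e i = e j \<longleftrightarrow> i = j" if "i < n" "j < n" for i j
    using bij_betw_imp_inj_on[OF e] that by (auto simp: inj_on_def)
  have entry: "(tomat C * tomat D) $$ (i, j) = (\<Sum>k\<in>I. C (e i) k * D k (e j))"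
    if "i < n" "j < n" for C D i j
    using that sum.reindex_bij_betw[OF e, of "\<lambda>k. C (e i) k * D k (e j)"]
    by (simp add: tomat_def scalar_prod_def)
  have "tomat A * tomat B = 1\<^sub>m n"
  proof (rule eq_matI)
    fix i j assume "i < dim_row (1\<^sub>m n :: complex mat)" "j < dim_col (1\<^sub>m n :: complex mat)"
    then show "(tomat A * tomat B) $$ (i, j) = 1\<^sub>m n $$ (i, j)"
      by (simp add: entry AB eI eq)
  qed (simp_all add: tomat_def)
  then have BA: "tomat B * tomat A = 1\<^sub>m n"
    by (rule mat_mult_left_right_inverse[OF carrier carrier])
  have "(\<Sum>k\<in>I. B i k * A k j) = (if i = j then 1 else 0)" if ij: "i \<in> I" "j \<in> I" for i j
  proof -
    obtain i' j' where "i' < n" "e i' = i" "j' < n" "e j' = j"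
      using bij_betw_imp_surj_on[OF e] ij by (metis atLeastLessThan_iff imageE)
    then show ?thesis using entry[of i' j' B A] BA eq[of i' j'] by auto
  qed
  then show ?thesis using AB by (simp add: is_inverse_matrix_def)
qed

lemma sum_fibers:
  assumes "finite A" "A \<subseteq> X \<times> H" "finite H"
  shows "sum g A = (\<Sum>h\<in>H. \<Sum>n\<in>{n. (n, h) \<in> A}. g (n, h))"
proof -
  have fin: "finite {n. (n, h) \<in> A}" for h
    by (rule finite_surj[OF assms(1), of _ fst]) force
  have "(\<Sum>h\<in>H. \<Sum>n\<in>{n. (n, h) \<in> A}. g (n, h)) = (\<Sum>(h, n)\<in>(SIGMA h:H. {n. (n, h) \<in> A}). g (n, h))"
    using fin assms(3) by (intro sum.Sigma) auto
  also have "\<dots> = sum g A"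
    using assms(2) by (intro sum.reindex_bij_witness[of _ "\<lambda>(n, h). (h, n)" "\<lambda>(h, n). (n, h)"]) auto
  finally show ?thesis by simp
qed

lemma L2_set_mono_set: "finite B \<Longrightarrow> A \<subseteq> B \<Longrightarrow> L2_set f A \<le> L2_set f B"
  unfolding L2_set_def by (intro real_sqrt_le_mono sum_mono2) auto

lemma L2_set_fiber_le:
  assumes "finite A"
  shows "L2_set (\<lambda>n. g (n, h)) {n. (n, h) \<in> A} \<le> L2_set g A"
proof -
  have "L2_set (\<lambda>n. g (n, h)) {n. (n, h) \<in> A} = L2_set g ((\<lambda>n. (n, h)) ` {n. (n, h) \<in> A})"
    unfolding L2_set_def by (subst sum.reindex) (auto simp: inj_on_def)
  also have "\<dots> \<le> L2_set g A" by (intro L2_set_mono_set assms) auto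
  finally show ?thesis .
qed

lemma has_sum_Times_finite:
  fixes g :: "'a \<times> 'b \<Rightarrow> 'c::topological_comm_monoid_add"
  assumes "finite H" and "\<And>h. h \<in> H \<Longrightarrow> ((\<lambda>n. g (n, h)) has_sum s h) X"
  shows "(g has_sum (\<Sum>h\<in>H. s h)) (X \<times> H)"
proof -
  have "(g has_sum (\<Sum>h\<in>H. s h)) (\<Union>h\<in>H. (\<lambda>n. (n, h)) ` X)"
  proof (rule sum_has_sum)
    fix h assume "h \<in> H"
    then show "(g has_sum s h) ((\<lambda>n. (n, h)) ` X)"
      using assms(2) by (subst has_sum_reindex) (auto simp: inj_on_def comp_def)
  qed (use assms in auto)
  also have "(\<Union>h\<in>H. (\<lambda>n. (n, h)) ` X) = X \<times> H" by auto
  finally show ?thesis .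
qed

lemma norm2_bounded_mult:
  assumes F: "essentially_bounded M F"
  shows "\<exists>C\<ge>0. \<forall>v. square_integrable M v \<longrightarrow> norm2 M (\<lambda>x. F x * v x) \<le> C * norm2 M v"
proof -
  obtain C where C: "AE x in M. cmod (F x) \<le> C" using F by (auto simp: essentially_bounded_def)
  \<comment> \<open>The essential bound may be negative if M is the null measure, hence the absolute
    value.\<close>
  have "norm2 M (\<lambda>x. F x * v x) \<le> \<bar>C\<bar> * norm2 M v" if v: "square_integrable M v" for v
  proof -
    have "(\<integral>x. (cmod (F x * v x))\<^sup>2 \<partial>M) \<le> (\<integral>x. C\<^sup>2 * (cmod (v x))\<^sup>2 \<partial>M)"
    proof (rule integral_mono_AE)
      show "AE x in M. (cmod (F x * v x))\<^sup>2 \<le> C\<^sup>2 * (cmod (v x))\<^sup>2"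
        using C by eventually_elim (auto simp: norm_mult power_mult_distrib intro!: mult_right_mono power_mono)
    qed (use v square_integrable_bounded_mult[OF F v] in \<open>simp_all add: square_integrable_def\<close>)
    then have "(\<integral>x. (cmod (F x * v x))\<^sup>2 \<partial>M) \<le> C\<^sup>2 * (\<integral>x. (cmod (v x))\<^sup>2 \<partial>M)" by simp
    then show ?thesis
      unfolding norm2_def using real_sqrt_le_mono by (fastforce simp: real_sqrt_mult)
  qed
  then show ?thesis by (intro exI[of _ "\<bar>C\<bar>"]) auto
qed

section \<open>Convolution forms and uniqueness of Fourier coefficients\<close>

context dual_haar
begin

lemma norm2_trig_poly_L2_set:
  assumes "finite A" "A \<subseteq> carrier N"
  shows "norm2 \<mu> (trig_poly A a) = L2_set (\<lambda>n. cmod (a n)) A"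
  using norm2_trig_poly[OF assms, of a] norm2_nonneg unfolding L2_set_def
  by (metis real_sqrt_unique)

text \<open>On the Fourier side convolution is multiplication: \<open>a (inv m \<otimes> n)\<close>
  is the (n, m) entry, in the orthonormal system of characters, of multiplication by \<phi>.\<close>

lemma integral_transform_trig_polys:
  assumes \<phi>: "l2_transform a \<phi>" and bd: "essentially_bounded \<mu> \<phi>"
    and A: "finite A" "A \<subseteq> carrier N" and B: "finite B" "B \<subseteq> carrier N"
  shows "(\<Sum>n\<in>A. \<Sum>m\<in>B. a (inv m \<otimes> n) * c m * cnj (d n))
    = (\<integral>\<xi>. \<phi> \<xi> * trig_poly B c \<xi> * cnj (trig_poly A d \<xi>) \<partial>\<mu>)"
proof -
  have inner: "(\<integral>\<xi>. \<phi> \<xi> * cnj (trig_poly A d \<xi>) * \<xi> (inv m) \<partial>\<mu>) = (\<Sum>n\<in>A. a (inv m \<otimes> n) * cnj (d n))"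
    if m: "m \<in> B" for m
  proof -
    have mN: "m \<in> carrier N" using m B by auto
    have u: "square_integrable \<mu> (\<lambda>\<xi>. cnj (\<phi> \<xi> * \<xi> (inv m)))"
      using mN by (intro square_integrable_cnj square_integrable_mult_char
          l2_transform_square_integrable[OF \<phi>]) simp
    have "(\<integral>\<xi>. \<phi> \<xi> * cnj (trig_poly A d \<xi>) * \<xi> (inv m) \<partial>\<mu>)
        = cnj (\<integral>\<xi>. cnj (\<phi> \<xi> * \<xi> (inv m)) * trig_poly A d \<xi> \<partial>\<mu>)"
      unfolding Bochner_Integration.integral_cnj[symmetric] by (simp add: mult_ac)
    also have "\<dots> = cnj (\<Sum>n\<in>A. d n * (\<integral>\<xi>. cnj (\<phi> \<xi> * \<xi> (inv m)) * \<xi> (inv n) \<partial>\<mu>))"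
      by (simp only: integral_mult_trig_poly[OF A u])
    also have "\<dots> = (\<Sum>n\<in>A. cnj (d n) * (\<integral>\<xi>. \<phi> \<xi> * \<xi> (inv m \<otimes> n) \<partial>\<mu>))"
      unfolding cnj_sum complex_cnj_mult[of "d _"] Bochner_Integration.integral_cnj[symmetric]
      using A mN
      by (intro sum.cong arg_cong2[of _ _ _ _ "(*)"] Bochner_Integration.integral_cong refl)
        (auto simp: char_inv char_mult subset_iff)
    also have "\<dots> = (\<Sum>n\<in>A. a (inv m \<otimes> n) * cnj (d n))"
      using A mN by (intro sum.cong) (auto simp: l2_transform_inversion[OF \<phi>] subset_iff)
    finally show ?thesis .
  qed
  have "(\<integral>\<xi>. \<phi> \<xi> * trig_poly B c \<xi> * cnj (trig_poly A d \<xi>) \<partial>\<mu>)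
      = (\<integral>\<xi>. (\<phi> \<xi> * cnj (trig_poly A d \<xi>)) * trig_poly B c \<xi> \<partial>\<mu>)"
    by (simp add: mult_ac)
  also have "\<dots> = (\<Sum>m\<in>B. c m * (\<integral>\<xi>. \<phi> \<xi> * cnj (trig_poly A d \<xi>) * \<xi> (inv m) \<partial>\<mu>))"
    using A by (intro integral_mult_trig_poly B square_integrable_bounded_mult[OF bd]
        square_integrable_cnj square_integrable_trig_poly)
  also have "\<dots> = (\<Sum>m\<in>B. \<Sum>n\<in>A. a (inv m \<otimes> n) * c m * cnj (d n))"
  proof (intro sum.cong refl)
    fix m assume "m \<in> B"
    show "c m * (\<integral>\<xi>. \<phi> \<xi> * cnj (trig_poly A d \<xi>) * \<xi> (inv m) \<partial>\<mu>)
        = (\<Sum>n\<in>A. a (inv m \<otimes> n) * c m * cnj (d n))"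
      unfolding inner[OF \<open>m \<in> B\<close>] by (simp add: sum_distrib_left mult_ac)
  qed
  also have "\<dots> = (\<Sum>n\<in>A. \<Sum>m\<in>B. a (inv m \<otimes> n) * c m * cnj (d n))"
    by (rule sum.swap)
  finally show ?thesis by simp
qed

text \<open>An essential bound of \<phi> bounds multiplication by \<phi> on L^2, and Parseval turns
  the norms of the polynomials into Euclidean norms. One C therefore serves all finite sets and all
  coefficients.\<close>

lemma convolution_form_bound:
  assumes \<phi>: "l2_transform a \<phi>" and bd: "essentially_bounded \<mu> \<phi>"
  shows "\<exists>C\<ge>0. \<forall>A B c d. finite A \<longrightarrow> A \<subseteq> carrier N \<longrightarrow> finite B \<longrightarrow> B \<subseteq> carrier N \<longrightarrow>
    cmod (\<Sum>n\<in>A. \<Sum>m\<in>B. a (inv m \<otimes> n) * c m * cnj (d n))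
      \<le> C * L2_set (\<lambda>m. cmod (c m)) B * L2_set (\<lambda>n. cmod (d n)) A"
proof -
  obtain C where C: "C \<ge> 0"
    "\<And>v. square_integrable \<mu> v \<Longrightarrow> norm2 \<mu> (\<lambda>\<xi>. \<phi> \<xi> * v \<xi>) \<le> C * norm2 \<mu> v"
    using norm2_bounded_mult[OF bd] by blast
  have "cmod (\<Sum>n\<in>A. \<Sum>m\<in>B. a (inv m \<otimes> n) * c m * cnj (d n))
      \<le> C * L2_set (\<lambda>m. cmod (c m)) B * L2_set (\<lambda>n. cmod (d n)) A"
    if A: "finite A" "A \<subseteq> carrier N" and B: "finite B" "B \<subseteq> carrier N" for A B c d
  proof -
    have tB: "square_integrable \<mu> (trig_poly B c)" and tA: "square_integrable \<mu> (trig_poly A d)"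
      using A B by (simp_all add: square_integrable_trig_poly)
    have "cmod (\<integral>\<xi>. \<phi> \<xi> * trig_poly B c \<xi> * cnj (trig_poly A d \<xi>) \<partial>\<mu>)
        \<le> norm2 \<mu> (\<lambda>\<xi>. \<phi> \<xi> * trig_poly B c \<xi>) * norm2 \<mu> (\<lambda>\<xi>. cnj (trig_poly A d \<xi>))"
      by (intro norm2_Cauchy_Schwarz' square_integrable_cnj square_integrable_bounded_mult bd tA tB)
    also have "norm2 \<mu> (\<lambda>\<xi>. cnj (trig_poly A d \<xi>)) = norm2 \<mu> (trig_poly A d)"
      by (simp add: norm2_def)
    also have "norm2 \<mu> (\<lambda>\<xi>. \<phi> \<xi> * trig_poly B c \<xi>) * norm2 \<mu> (trig_poly A d)
        \<le> (C * norm2 \<mu> (trig_poly B c)) * norm2 \<mu> (trig_poly A d)"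
      by (intro mult_right_mono C(2) tB norm2_nonneg)
    finally show ?thesis
      by (simp add: integral_transform_trig_polys[OF \<phi> bd A B] norm2_trig_poly_L2_set A B)
  qed
  with C(1) show ?thesis by blast
qed

text \<open>Both Gram sums take this shape: p is a translation when the point of \<Gamma> is summed,
  and an inversion followed by a translation when the group element is; in both cases p and q differ
  by the fixed factor k.\<close>

lemma l2_transform_Parseval_reindex:
  assumes \<phi>: "l2_transform a \<phi>" and \<psi>: "l2_transform b \<psi>" and k: "k \<in> carrier N"
    and p: "bij_betw p (carrier N) (carrier N)"
    and q: "\<And>n. n \<in> carrier N \<Longrightarrow> q n = p n \<otimes> k"
  shows "((\<lambda>n. a (q n) * cnj (b (p n))) has_sum (\<integral>\<xi>. \<phi> \<xi> * cnj (\<psi> \<xi>) * \<xi> k \<partial>\<mu>)) (carrier N)"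
proof -
  have "((\<lambda>n. a (p n \<otimes> k) * cnj (b (p n))) has_sum (\<integral>\<xi>. \<phi> \<xi> * cnj (\<psi> \<xi>) * \<xi> k \<partial>\<mu>)) (carrier N)"
    using l2_transform_Parseval[OF \<phi> \<psi> k] has_sum_reindex_bij_betw[OF p, of "\<lambda>n. a (n \<otimes> k) * cnj (b n)"]
    by simp
  then show ?thesis by (simp add: q cong: has_sum_cong)
qed

lemma bij_betw_mult_left: "m \<in> carrier N \<Longrightarrow> bij_betw (\<lambda>n. inv m \<otimes> n) (carrier N) (carrier N)"
  by (rule bij_betw_byWitness[where f' = "\<lambda>n. m \<otimes> n"]) (auto simp: m_assoc[symmetric])

lemma bij_betw_inv_mult: "n \<in> carrier N \<Longrightarrow> bij_betw (\<lambda>m. inv m \<otimes> n) (carrier N) (carrier N)"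
  by (rule bij_betw_byWitness[where f' = "\<lambda>m. n \<otimes> inv m"]) (auto simp: inv_mult m_ac inv_mult_group)

lemma integral_cnj_self_eq_0_imp_AE:
  assumes D: "square_integrable \<mu> D" and 0: "(\<integral>\<xi>. cnj (D \<xi>) * D \<xi> \<partial>\<mu>) = 0"
  shows "AE \<xi> in \<mu>. D \<xi> = 0"
proof -
  have "complex_of_real (\<integral>\<xi>. (cmod (D \<xi>))\<^sup>2 \<partial>\<mu>) = (\<integral>\<xi>. complex_of_real ((cmod (D \<xi>))\<^sup>2) \<partial>\<mu>)"
    by (simp only: integral_complex_of_real)
  also have "\<dots> = 0" using 0 by (simp only: complex_norm_square mult.commute)
  finally have "(\<integral>\<xi>. (cmod (D \<xi>))\<^sup>2 \<partial>\<mu>) = 0" by simp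
  then have "AE \<xi> in \<mu>. (cmod (D \<xi>))\<^sup>2 = 0"
    using D by (subst (asm) integral_nonneg_eq_0_iff_AE) (auto simp: square_integrable_def)
  then show ?thesis by simp
qed

text \<open>One factor D of the squared modulus is expanded. The conjugate of D is then paired with
  products of two transforms and with a constant, and multiplying by the transforms one at a time
  keeps it orthogonal to all characters.\<close>

lemma sum_transform_products_AE:
  assumes fin: "finite I"
    and \<phi>: "\<And>h. h \<in> I \<Longrightarrow> l2_transform (a h) (\<phi> h)" and \<phi>_bd: "\<And>h. h \<in> I \<Longrightarrow> essentially_bounded \<mu> (\<phi> h)"
    and \<psi>: "\<And>h. h \<in> I \<Longrightarrow> l2_transform (b h) (\<psi> h)" and \<psi>_bd: "\<And>h. h \<in> I \<Longrightarrow> essentially_bounded \<mu> (\<psi> h)"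
    and coeffs: "\<And>k. k \<in> carrier N \<Longrightarrow>
      (\<Sum>h\<in>I. \<integral>\<xi>. \<phi> h \<xi> * cnj (\<psi> h \<xi>) * \<xi> k \<partial>\<mu>) = (if k = \<one> then c else 0)"
  shows "AE \<xi> in \<mu>. (\<Sum>h\<in>I. \<phi> h \<xi> * cnj (\<psi> h \<xi>)) = c"
proof -
  define D where "D \<xi> = (\<Sum>h\<in>I. \<phi> h \<xi> * cnj (\<psi> h \<xi>)) + (- c)" for \<xi>
  have prod: "essentially_bounded \<mu> (\<lambda>\<xi>. \<phi> h \<xi> * cnj (\<psi> h \<xi>))" if "h \<in> I" for h
    using that by (intro essentially_bounded_mult essentially_bounded_cnj \<phi>_bd \<psi>_bd)
  have D: "essentially_bounded \<mu> D"
    unfolding D_def by (intro essentially_bounded_add essentially_bounded_sum essentially_bounded_const prod)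
  note sq = square_integrable_essentially_bounded
  have expand: "(\<integral>\<xi>. u \<xi> * D \<xi> \<partial>\<mu>) = (\<Sum>h\<in>I. \<integral>\<xi>. u \<xi> * (\<phi> h \<xi> * cnj (\<psi> h \<xi>)) \<partial>\<mu>) - c * (\<integral>\<xi>. u \<xi> \<partial>\<mu>)"
    if u: "essentially_bounded \<mu> u" for u
  proof -
    have int: "integrable \<mu> (\<lambda>\<xi>. u \<xi> * (\<phi> h \<xi> * cnj (\<psi> h \<xi>)))" if "h \<in> I" for h
      using that by (intro square_integrable_mult_integrable sq u prod)
    have intu: "integrable \<mu> u"
      using square_integrable_mult_integrable[OF sq[OF u] sq[OF essentially_bounded_const[of _ 1]]] by simp
    have "(\<integral>\<xi>. u \<xi> * D \<xi> \<partial>\<mu>) = (\<integral>\<xi>. (\<Sum>h\<in>I. u \<xi> * (\<phi> h \<xi> * cnj (\<psi> h \<xi>))) - c * u \<xi> \<partial>\<mu>)"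
      by (simp add: D_def distrib_left sum_distrib_left right_diff_distrib mult.commute)
    also have "\<dots> = (\<integral>\<xi>. (\<Sum>h\<in>I. u \<xi> * (\<phi> h \<xi> * cnj (\<psi> h \<xi>))) \<partial>\<mu>) - (\<integral>\<xi>. c * u \<xi> \<partial>\<mu>)"
      using int intu by (intro Bochner_Integration.integral_diff) auto
    also have "(\<integral>\<xi>. (\<Sum>h\<in>I. u \<xi> * (\<phi> h \<xi> * cnj (\<psi> h \<xi>))) \<partial>\<mu>)
        = (\<Sum>h\<in>I. \<integral>\<xi>. u \<xi> * (\<phi> h \<xi> * cnj (\<psi> h \<xi>)) \<partial>\<mu>)"
      using int by (intro Bochner_Integration.integral_sum) auto
    finally show ?thesis by simp
  qed
  have "annihilates_chars D"
    unfolding annihilates_chars_def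
  proof
    fix k assume k: "k \<in> carrier N"
    have "(\<integral>\<xi>. D \<xi> * \<xi> k \<partial>\<mu>) = (\<integral>\<xi>. \<xi> k * D \<xi> \<partial>\<mu>)" by (simp add: mult.commute)
    also have "\<dots> = (\<Sum>h\<in>I. \<integral>\<xi>. \<xi> k * (\<phi> h \<xi> * cnj (\<psi> h \<xi>)) \<partial>\<mu>) - c * (\<integral>\<xi>. \<xi> k \<partial>\<mu>)"
      by (rule expand[OF essentially_bounded_char[OF k]])
    also have "\<dots> = 0" using coeffs[OF k] by (simp add: integral_char[OF k] mult_ac)
    finally show "(\<integral>\<xi>. D \<xi> * \<xi> k \<partial>\<mu>) = 0" .
  qed
  define u where "u \<xi> = cnj (D \<xi>)" for \<xi>
  have u: "essentially_bounded \<mu> u" "annihilates_chars u"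
    unfolding u_def using D \<open>annihilates_chars D\<close>
    by (auto intro: essentially_bounded_cnj annihilates_chars_cnj)
  \<comment> \<open>Evaluation at the identity of N is the constant function 1, so orthogonality to
    all characters includes a vanishing integral.\<close>
  have at_one: "(\<integral>\<xi>. v \<xi> \<partial>\<mu>) = 0" if v: "annihilates_chars v" for v
  proof -
    have "(\<integral>\<xi>. v \<xi> \<partial>\<mu>) = (\<integral>\<xi>. v \<xi> * \<xi> \<one> \<partial>\<mu>)"
      by (intro Bochner_Integration.integral_cong) (simp_all add: char_one)
    then show ?thesis using v by (simp add: annihilates_chars_def)
  qed
  have "(\<integral>\<xi>. u \<xi> * (\<phi> h \<xi> * cnj (\<psi> h \<xi>)) \<partial>\<mu>) = 0" if h: "h \<in> I" for h
  proof -
    have "annihilates_chars (\<lambda>\<xi>. u \<xi> * \<phi> h \<xi>)"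
      by (rule annihilates_chars_mult[OF sq[OF u(1)] u(2) \<phi>[OF h]])
    \<comment> \<open>The second multiplication requires a square integrable function; this holds
      because u and the first transform are both essentially bounded.\<close>
    then have "annihilates_chars (\<lambda>\<xi>. u \<xi> * \<phi> h \<xi> * cnj (\<psi> h \<xi>))"
      by (intro annihilates_chars_mult_cnj[OF _ _ \<psi>[OF h]] sq essentially_bounded_mult u \<phi>_bd h)
    then show ?thesis using at_one by (simp add: mult.assoc)
  qed
  then have "(\<integral>\<xi>. cnj (D \<xi>) * D \<xi> \<partial>\<mu>) = 0"
    using expand[OF u(1)] at_one[OF u(2)] by (simp add: u_def)
  then have "AE \<xi> in \<mu>. D \<xi> = 0"
    by (intro integral_cnj_self_eq_0_imp_AE sq D)
  then show ?thesis by (simp add: D_def)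
qed

end

section \<open>Transfer matrices\<close>

locale semidirect_dual_haar = dual_haar N \<mu> + H: group H
  for N :: "('n, 'c) monoid_scheme" (structure) and \<mu> :: "('n \<Rightarrow> complex) measure"
    and H :: "('h, 'd) monoid_scheme" +
  fixes \<sigma> :: "'h \<Rightarrow> 'n \<Rightarrow> 'n"
  assumes finite_H: "finite (carrier H)" and \<sigma>_hom: "\<sigma> \<in> hom H (AutoGroup N)"
begin

abbreviation \<Gamma> :: "('n \<times> 'h) monoid" where
  "\<Gamma> \<equiv> semidirect_product N H \<sigma>"

lemma carrier_\<Gamma>: "carrier \<Gamma> = carrier N \<times> carrier H"
  and mult_\<Gamma>: "(n, h) \<otimes>\<^bsub>\<Gamma>\<^esub> (m, l) = (n \<otimes> \<sigma> h m, h \<otimes>\<^bsub>H\<^esub> l)"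
  and one_\<Gamma>: "\<one>\<^bsub>\<Gamma>\<^esub> = (\<one>, \<one>\<^bsub>H\<^esub>)"
  by (simp_all add: semidirect_product_def)

lemma \<sigma>_auto: "h \<in> carrier H \<Longrightarrow> \<sigma> h \<in> auto N"
  using hom_in_carrier[OF \<sigma>_hom] by (simp add: AutoGroup_def)

lemma \<sigma>_closed [simp]: "h \<in> carrier H \<Longrightarrow> n \<in> carrier N \<Longrightarrow> \<sigma> h n \<in> carrier N"
  using \<sigma>_auto[of h] by (auto simp: auto_def hom_def)

lemma \<sigma>_mult:
  "h \<in> carrier H \<Longrightarrow> n \<in> carrier N \<Longrightarrow> m \<in> carrier N \<Longrightarrow> \<sigma> h (n \<otimes> m) = \<sigma> h n \<otimes> \<sigma> h m"
  using \<sigma>_auto[of h] by (auto simp: auto_def hom_def)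

lemma \<sigma>_comp:
  assumes "h \<in> carrier H" "l \<in> carrier H" "n \<in> carrier N"
  shows "\<sigma> (h \<otimes>\<^bsub>H\<^esub> l) n = \<sigma> h (\<sigma> l n)"
proof -
  have "\<sigma> h \<in> Bij (carrier N)" "\<sigma> l \<in> Bij (carrier N)"
    using \<sigma>_auto assms by (auto simp: auto_def)
  then show ?thesis
    using hom_mult[OF \<sigma>_hom assms(1,2)] assms(3)
    by (simp add: AutoGroup_def BijGroup_def compose_eq)
qed

lemma \<sigma>_one: "n \<in> carrier N \<Longrightarrow> \<sigma> \<one>\<^bsub>H\<^esub> n = n"
  using hom_one[OF \<sigma>_hom H.is_group AutoGroup] by (simp add: AutoGroup_def BijGroup_def)

lemma \<sigma>_fix_one: "h \<in> carrier H \<Longrightarrow> \<sigma> h \<one> = \<one>"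
  using \<sigma>_mult[of h \<one> \<one>] r_cancel_one[of "\<sigma> h \<one>" "\<sigma> h \<one>"] by simp

lemma group_\<Gamma>: "group \<Gamma>"
proof (rule groupI)
  fix x y z assume "x \<in> carrier \<Gamma>" "y \<in> carrier \<Gamma>" "z \<in> carrier \<Gamma>"
  then show "x \<otimes>\<^bsub>\<Gamma>\<^esub> y \<otimes>\<^bsub>\<Gamma>\<^esub> z = x \<otimes>\<^bsub>\<Gamma>\<^esub> (y \<otimes>\<^bsub>\<Gamma>\<^esub> z)"
    by (auto simp: carrier_\<Gamma> mult_\<Gamma> \<sigma>_mult \<sigma>_comp m_assoc H.m_assoc)
next
  fix x assume "x \<in> carrier \<Gamma>"
  then obtain n h where x: "x = (n, h)" "n \<in> carrier N" "h \<in> carrier H" by (auto simp: carrier_\<Gamma>)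
  have "(\<sigma> (inv\<^bsub>H\<^esub> h) (inv n), inv\<^bsub>H\<^esub> h) \<otimes>\<^bsub>\<Gamma>\<^esub> x = \<one>\<^bsub>\<Gamma>\<^esub>"
    using x by (simp add: mult_\<Gamma> one_\<Gamma> \<sigma>_mult[symmetric] \<sigma>_fix_one)
  then show "\<exists>y\<in>carrier \<Gamma>. y \<otimes>\<^bsub>\<Gamma>\<^esub> x = \<one>\<^bsub>\<Gamma>\<^esub>"
    using x by (intro bexI[of _ "(\<sigma> (inv\<^bsub>H\<^esub> h) (inv n), inv\<^bsub>H\<^esub> h)"]) (auto simp: carrier_\<Gamma>)
qed (auto simp: carrier_\<Gamma> mult_\<Gamma> one_\<Gamma> \<sigma>_one)

lemma inv_\<Gamma>:
  assumes "n \<in> carrier N" "h \<in> carrier H"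
  shows "inv\<^bsub>\<Gamma>\<^esub> (n, h) = (\<sigma> (inv\<^bsub>H\<^esub> h) (inv n), inv\<^bsub>H\<^esub> h)"
  using assms by (intro group.inv_equality[OF group_\<Gamma>])
    (auto simp: carrier_\<Gamma> mult_\<Gamma> one_\<Gamma> \<sigma>_mult[symmetric] \<sigma>_fix_one)

abbreviation component :: "('n \<times> 'h \<Rightarrow> complex) \<Rightarrow> 'h \<Rightarrow> 'h \<Rightarrow> 'n \<Rightarrow> complex" where
  "component \<equiv> transfer_component N H \<sigma>"

abbreviation transfer :: "('n \<times> 'h \<Rightarrow> complex) \<Rightarrow> ('n \<Rightarrow> complex) \<Rightarrow> 'h \<Rightarrow> 'h \<Rightarrow> complex" where
  "transfer \<equiv> transfer_matrix N H \<sigma> \<mu>"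

lemma component_eq:
  assumes "n \<in> carrier N" "h \<in> carrier H" "l \<in> carrier H"
  shows "component f h l n = f (\<sigma> (inv\<^bsub>H\<^esub> l) n, inv\<^bsub>H\<^esub> l \<otimes>\<^bsub>H\<^esub> h)"
  using assms by (simp add: transfer_component_def inv_\<Gamma> mult_\<Gamma> \<sigma>_fix_one)

text \<open>Writing \<open>(m, l) = (m, 1) (0, l)\<close>, the first factor acts on the components by translation.\<close>

lemma left_regular_component:
  assumes "m \<in> carrier N" "n \<in> carrier N" "h \<in> carrier H" "l \<in> carrier H"
  shows "left_regular \<Gamma> (m, l) f (n, h) = component f h l (inv m \<otimes> n)"
  using assms
  by (simp add: left_regular_def component_eq carrier_\<Gamma> inv_\<Gamma> mult_\<Gamma> \<sigma>_mult)

text \<open>A component is f read along an injection of N into \<Gamma>, so its squares form a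
  subfamily of those of f.\<close>

lemma component_ell2:
  assumes f: "f \<in> ell2 (carrier \<Gamma>)" and "h \<in> carrier H" "l \<in> carrier H"
  shows "component f h l \<in> ell2 (carrier N)"
proof -
  let ?p = "\<lambda>n. (\<sigma> (inv\<^bsub>H\<^esub> l) n, inv\<^bsub>H\<^esub> l \<otimes>\<^bsub>H\<^esub> h)"
  have "inj_on (\<sigma> (inv\<^bsub>H\<^esub> l)) (carrier N)"
    using \<sigma>_auto[of "inv\<^bsub>H\<^esub> l"] assms by (auto simp: auto_def Bij_def bij_betw_def)
  then have inj: "inj_on ?p (carrier N)" by (auto simp: inj_on_def)
  have "(\<lambda>x. (cmod (f x))\<^sup>2) summable_on (?p ` carrier N)"
    by (rule summable_on_subset_banach[OF ell2_summable[OF f]]) (use assms in \<open>auto simp: carrier_\<Gamma>\<close>)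
  then have "(\<lambda>n. (cmod (f (?p n)))\<^sup>2) summable_on carrier N"
    using inj by (simp add: summable_on_reindex comp_def)
  then have "(\<lambda>n. (cmod (component f h l n))\<^sup>2) summable_on carrier N"
    using assms by (simp add: component_eq cong: summable_on_cong)
  then show ?thesis by (simp add: ell2_def transfer_component_def)
qed

lemma transfer_l2_transform:
  assumes "f \<in> ell2 (carrier \<Gamma>)" "h \<in> carrier H" "l \<in> carrier H"
  shows "l2_transform (component f h l) (\<lambda>\<xi>. transfer f \<xi> h l)"
  using fourier_l2_transform[OF component_ell2[OF assms]] by (simp add: transfer_matrix_def[abs_def])

definition bounded_transfer :: "('n \<times> 'h \<Rightarrow> complex) \<Rightarrow> bool" where
  "bounded_transfer f \<longleftrightarrow> f \<in> ell2 (carrier \<Gamma>) \<and>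
    (\<forall>h\<in>carrier H. \<forall>l\<in>carrier H. essentially_bounded \<mu> (\<lambda>\<xi>. transfer f \<xi> h l))"

lemma bounded_transferD:
  assumes "bounded_transfer f" "h \<in> carrier H" "l \<in> carrier H"
  shows "l2_transform (component f h l) (\<lambda>\<xi>. transfer f \<xi> h l)"
    and "essentially_bounded \<mu> (\<lambda>\<xi>. transfer f \<xi> h l)"
  using assms transfer_l2_transform by (auto simp: bounded_transfer_def)

text \<open>Slicing \<Gamma> into copies of N indexed by H, for rows and for columns, leaves
  finitely many blocks, each the convolution form of one component. Slices of c and d are no longer
  than c and d, so the block constants add up.\<close>

lemma bounded_matrix_left_regular:
  assumes f: "bounded_transfer f"
  shows "\<exists>C\<ge>0. bounded_matrix (carrier \<Gamma>) C (\<lambda>\<zeta> \<gamma>. left_regular \<Gamma> \<gamma> f \<zeta>)"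
proof -
  define P where "P h l C \<longleftrightarrow> C \<ge> 0 \<and>
    (\<forall>A B c d. finite A \<longrightarrow> A \<subseteq> carrier N \<longrightarrow> finite B \<longrightarrow> B \<subseteq> carrier N \<longrightarrow>
      cmod (\<Sum>n\<in>A. \<Sum>m\<in>B. component f h l (inv m \<otimes> n) * c m * cnj (d n))
      \<le> C * L2_set (\<lambda>m. cmod (c m)) B * L2_set (\<lambda>n. cmod (d n)) A)" for h l C
  \<comment> \<open>Choosing a constant for each block turns the existence statements into a family
    that can be summed.\<close>
  define C where "C h l = (SOME C. P h l C)" for h l
  have P: "P h l (C h l)" if "h \<in> carrier H" "l \<in> carrier H" for h l
    unfolding C_def
    by (rule someI_ex) (use convolution_form_bound[OF bounded_transferD[OF f that]] in \<open>simp only: P_def\<close>)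
  have C: "C h l \<ge> 0"
    "finite A \<Longrightarrow> A \<subseteq> carrier N \<Longrightarrow> finite B \<Longrightarrow> B \<subseteq> carrier N \<Longrightarrow>
      cmod (\<Sum>n\<in>A. \<Sum>m\<in>B. component f h l (inv m \<otimes> n) * c m * cnj (d n))
      \<le> C h l * L2_set (\<lambda>m. cmod (c m)) B * L2_set (\<lambda>n. cmod (d n)) A"
    if "h \<in> carrier H" "l \<in> carrier H" for h l A B c d
    using P[OF that] unfolding P_def by simp_all
  let ?C = "\<Sum>h\<in>carrier H. \<Sum>l\<in>carrier H. C h l"
  let ?K = "\<lambda>\<zeta> \<gamma>. left_regular \<Gamma> \<gamma> f \<zeta>"
  have "bounded_matrix (carrier \<Gamma>) ?C ?K"
    unfolding bounded_matrix_def
  proof (intro allI impI)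
    fix A B :: "('n \<times> 'h) set" and c d
    assume fin: "finite A" "finite B" and sub: "A \<subseteq> carrier \<Gamma>" "B \<subseteq> carrier \<Gamma>"
    let ?A = "\<lambda>h. {n. (n, h) \<in> A}" and ?B = "\<lambda>l. {m. (m, l) \<in> B}"
    let ?c = "L2_set (\<lambda>y. cmod (c y)) B" and ?d = "L2_set (\<lambda>x. cmod (d x)) A"
    have "?A h \<subseteq> fst ` A" "?B h \<subseteq> fst ` B" for h by force+
    then have fin': "finite (?A h)" "finite (?B h)" for h
      using fin by (meson finite_imageI finite_subset)+
    have sub': "?A h \<subseteq> carrier N" "?B h \<subseteq> carrier N" for h
      using sub by (auto simp: carrier_\<Gamma>)
    have "(\<Sum>x\<in>A. \<Sum>y\<in>B. ?K x y * c y * cnj (d x))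
        = (\<Sum>h\<in>carrier H. \<Sum>n\<in>?A h. \<Sum>l\<in>carrier H. \<Sum>m\<in>?B l. ?K (n, h) (m, l) * c (m, l) * cnj (d (n, h)))"
      unfolding sum_fibers[OF fin(1) sub(1)[unfolded carrier_\<Gamma>] finite_H]
        sum_fibers[OF fin(2) sub(2)[unfolded carrier_\<Gamma>] finite_H] ..
    also have "\<dots> = (\<Sum>h\<in>carrier H. \<Sum>l\<in>carrier H. \<Sum>n\<in>?A h. \<Sum>m\<in>?B l.
        component f h l (inv m \<otimes> n) * c (m, l) * cnj (d (n, h)))"
    proof (rule sum.cong[OF refl])
      fix h assume h: "h \<in> carrier H"
      have "?K (n, h) (m, l) = component f h l (inv m \<otimes> n)"
        if "n \<in> ?A h" "l \<in> carrier H" "m \<in> ?B l" for n m l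
        using that sub' h by (intro left_regular_component) auto
      then show "(\<Sum>n\<in>?A h. \<Sum>l\<in>carrier H. \<Sum>m\<in>?B l. ?K (n, h) (m, l) * c (m, l) * cnj (d (n, h)))
          = (\<Sum>l\<in>carrier H. \<Sum>n\<in>?A h. \<Sum>m\<in>?B l. component f h l (inv m \<otimes> n) * c (m, l) * cnj (d (n, h)))"
        by (subst sum.swap) (intro sum.cong refl, simp)
    qed
    also have "cmod \<dots> \<le> (\<Sum>h\<in>carrier H. \<Sum>l\<in>carrier H. C h l * ?c * ?d)"
    proof (intro sum_norm_le)
      fix h l assume hl: "h \<in> carrier H" "l \<in> carrier H"
      have "cmod (\<Sum>n\<in>?A h. \<Sum>m\<in>?B l. component f h l (inv m \<otimes> n) * c (m, l) * cnj (d (n, h)))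
        \<le> C h l * L2_set (\<lambda>m. cmod (c (m, l))) (?B l) * L2_set (\<lambda>n. cmod (d (n, h))) (?A h)"
        by (rule C(2)[OF hl fin'(1) sub'(1) fin'(2) sub'(2)])
      also have "\<dots> \<le> C h l * ?c * ?d"
        using L2_set_fiber_le[OF fin(1), of "\<lambda>x. cmod (d x)" h] L2_set_fiber_le[OF fin(2), of "\<lambda>x. cmod (c x)" l]
        by (intro mult_mono mult_left_mono mult_nonneg_nonneg C(1) hl L2_set_nonneg)
      finally show "cmod (\<Sum>n\<in>?A h. \<Sum>m\<in>?B l. component f h l (inv m \<otimes> n) * c (m, l) * cnj (d (n, h)))
        \<le> C h l * ?c * ?d" .
    qed
    also have "\<dots> = ?C * ?c * ?d" by (simp add: sum_distrib_right)
    finally show "cmod (\<Sum>x\<in>A. \<Sum>y\<in>B. ?K x y * c y * cnj (d x)) \<le> ?C * ?c * ?d" .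
  qed
  moreover have "?C \<ge> 0" using C(1) by (intro sum_nonneg)
  ultimately show ?thesis by blast
qed

section \<open>Gram sums and the transfer matrices\<close>

text \<open>For fixed h the two factors are components translated by m' and m; reindexing by the
  second translation leaves the relative shift \<open>m \<otimes> inv m'\<close>. The sum over h is
  a Fourier coefficient of the (l, l') entry of G^* F.\<close>

lemma gram_columns:
  assumes f: "bounded_transfer f" and g: "bounded_transfer g"
    and "m \<in> carrier N" "l \<in> carrier H" "m' \<in> carrier N" "l' \<in> carrier H"
  shows "((\<lambda>\<zeta>. left_regular \<Gamma> (m', l') f \<zeta> * cnj (left_regular \<Gamma> (m, l) g \<zeta>)) has_sum
    (\<Sum>h\<in>carrier H. \<integral>\<xi>. transfer f \<xi> h l' * cnj (transfer g \<xi> h l) * \<xi> (m \<otimes> inv m') \<partial>\<mu>)) (carrier \<Gamma>)"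
  unfolding carrier_\<Gamma>
proof (rule has_sum_Times_finite[OF finite_H])
  fix h assume h: "h \<in> carrier H"
  have "((\<lambda>n. component f h l' (inv m' \<otimes> n) * cnj (component g h l (inv m \<otimes> n))) has_sum
      (\<integral>\<xi>. transfer f \<xi> h l' * cnj (transfer g \<xi> h l) * \<xi> (m \<otimes> inv m') \<partial>\<mu>)) (carrier N)"
  proof (rule l2_transform_Parseval_reindex[OF bounded_transferD(1)[OF f h] bounded_transferD(1)[OF g h]])
    fix n assume n: "n \<in> carrier N"
    have "inv m \<otimes> n \<otimes> (m \<otimes> inv m') = (inv m \<otimes> m) \<otimes> (inv m' \<otimes> n)"
      using n assms by (simp only: m_ac inv_closed m_closed)
    then show "inv m' \<otimes> n = inv m \<otimes> n \<otimes> (m \<otimes> inv m')"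
      using n assms by simp
  qed (use assms in \<open>simp_all add: bij_betw_mult_left\<close>)
  then show "((\<lambda>n. left_regular \<Gamma> (m', l') f (n, h) * cnj (left_regular \<Gamma> (m, l) g (n, h))) has_sum
      (\<integral>\<xi>. transfer f \<xi> h l' * cnj (transfer g \<xi> h l) * \<xi> (m \<otimes> inv m') \<partial>\<mu>)) (carrier N)"
    using assms h by (simp add: left_regular_component cong: has_sum_cong)
qed

text \<open>Now the two points are fixed and the group element (m, l) is summed. For fixed l the
  index m enters as \<open>inv m \<otimes> n\<close>, again a bijection of N, and the sum runs over
  l, so the coefficient belongs to the (h', h) entry of F G^*.\<close>

lemma gram_rows:
  assumes f: "bounded_transfer f" and g: "bounded_transfer g"
    and "n \<in> carrier N" "h \<in> carrier H" "n' \<in> carrier N" "h' \<in> carrier H"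
  shows "((\<lambda>\<gamma>. left_regular \<Gamma> \<gamma> f (n', h') * cnj (left_regular \<Gamma> \<gamma> g (n, h))) has_sum
    (\<Sum>l\<in>carrier H. \<integral>\<xi>. transfer f \<xi> h' l * cnj (transfer g \<xi> h l) * \<xi> (inv n \<otimes> n') \<partial>\<mu>)) (carrier \<Gamma>)"
  unfolding carrier_\<Gamma>
proof (rule has_sum_Times_finite[OF finite_H])
  fix l assume l: "l \<in> carrier H"
  have "((\<lambda>m. component f h' l (inv m \<otimes> n') * cnj (component g h l (inv m \<otimes> n))) has_sum
      (\<integral>\<xi>. transfer f \<xi> h' l * cnj (transfer g \<xi> h l) * \<xi> (inv n \<otimes> n') \<partial>\<mu>)) (carrier N)"
  proof (rule l2_transform_Parseval_reindex[OF bounded_transferD(1)[OF f _ l] bounded_transferD(1)[OF g _ l]])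
    fix m assume m: "m \<in> carrier N"
    have "inv m \<otimes> n \<otimes> (inv n \<otimes> n') = inv m \<otimes> ((n \<otimes> inv n) \<otimes> n')"
      using m assms by (simp only: m_assoc inv_closed m_closed)
    then show "inv m \<otimes> n' = inv m \<otimes> n \<otimes> (inv n \<otimes> n')"
      using m assms by simp
  qed (use assms in \<open>simp_all add: bij_betw_inv_mult\<close>)
  then show "((\<lambda>m. left_regular \<Gamma> (m, l) f (n', h') * cnj (left_regular \<Gamma> (m, l) g (n, h))) has_sum
      (\<integral>\<xi>. transfer f \<xi> h' l * cnj (transfer g \<xi> h l) * \<xi> (inv n \<otimes> n') \<partial>\<mu>)) (carrier N)"
    using assms l by (simp add: left_regular_component cong: has_sum_cong)
qed

lemma sum_integrals_of_AE_const:
  assumes I: "finite I" and k: "k \<in> carrier N"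
    and u: "\<And>h. h \<in> I \<Longrightarrow> essentially_bounded \<mu> (u h)"
    and ae: "AE \<xi> in \<mu>. (\<Sum>h\<in>I. u h \<xi>) = c"
  shows "(\<Sum>h\<in>I. \<integral>\<xi>. u h \<xi> * \<xi> k \<partial>\<mu>) = (if k = \<one> then c else 0)"
proof -
  have meas: "u h \<in> borel_measurable \<mu>" if "h \<in> I" for h
    using u[OF that] by (simp add: essentially_bounded_def)
  have "(\<Sum>h\<in>I. \<integral>\<xi>. u h \<xi> * \<xi> k \<partial>\<mu>) = (\<integral>\<xi>. (\<Sum>h\<in>I. u h \<xi> * \<xi> k) \<partial>\<mu>)"
    using u by (intro Bochner_Integration.integral_sum[symmetric] square_integrable_mult_integrable
        square_integrable_essentially_bounded essentially_bounded_char k) auto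
  also have "\<dots> = (\<integral>\<xi>. c * \<xi> k \<partial>\<mu>)"
  proof (rule integral_cong_AE)
    show "AE \<xi> in \<mu>. (\<Sum>h\<in>I. u h \<xi> * \<xi> k) = c * \<xi> k"
      using ae by eventually_elim (simp add: sum_distrib_right[symmetric])
  qed (use meas measurable_char[OF k] in \<open>auto intro!: borel_measurable_sum borel_measurable_times\<close>)
  finally show ?thesis by (simp add: integral_char[OF k])
qed

text \<open>The conjugated product in a single order is the form in which Gram sums deliver the
  relation; finiteness of H restores the other order.\<close>

lemma is_inverse_transfer_iff:
  "is_inverse_matrix (carrier H) (conjugate_transpose (transfer f \<xi>)) (transfer g \<xi>) \<longleftrightarrow>
    (\<forall>i\<in>carrier H. \<forall>j\<in>carrier H.
      (\<Sum>h\<in>carrier H. transfer f \<xi> h i * cnj (transfer g \<xi> h j)) = (if i = j then 1 else 0))"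
  (is "?inv \<longleftrightarrow> ?gram")
proof
  assume ?inv
  then have inv: "(\<Sum>h\<in>carrier H. cnj (transfer f \<xi> h i) * transfer g \<xi> h j) = (if i = j then 1 else 0)"
    if "i \<in> carrier H" "j \<in> carrier H" for i j
    using that by (simp add: is_inverse_matrix_def conjugate_transpose_def)
  show ?gram
  proof (intro ballI)
    fix i j assume "i \<in> carrier H" "j \<in> carrier H"
    then show "(\<Sum>h\<in>carrier H. transfer f \<xi> h i * cnj (transfer g \<xi> h j)) = (if i = j then 1 else 0)"
      using arg_cong[OF inv, of i j cnj] by (simp split: if_splits)
  qed
next
  assume gram: ?gram
  show ?inv
  proof (rule is_inverse_matrix_if_left_inverse[OF finite_H])
    fix i j assume "i \<in> carrier H" "j \<in> carrier H"
    then have "(\<Sum>h\<in>carrier H. transfer f \<xi> h i * cnj (transfer g \<xi> h j)) = (if i = j then 1 else 0)"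
      using gram by blast
    from arg_cong[OF this, of cnj] show "(\<Sum>k\<in>carrier H. conjugate_transpose (transfer f \<xi>) i k * transfer g \<xi> k j) = (if i = j then 1 else 0)"
      by (simp add: conjugate_transpose_def split: if_splits)
  qed
qed

lemma inverse_transfer_imp_rows:
  assumes "is_inverse_matrix (carrier H) (conjugate_transpose (transfer f \<xi>)) (transfer g \<xi>)"
    and "i \<in> carrier H" "j \<in> carrier H"
  shows "(\<Sum>l\<in>carrier H. transfer f \<xi> i l * cnj (transfer g \<xi> j l)) = (if i = j then 1 else 0)"
proof -
  have "(\<Sum>l\<in>carrier H. transfer g \<xi> j l * cnj (transfer f \<xi> i l)) = (if j = i then 1 else 0)"
    using assms by (simp add: is_inverse_matrix_def conjugate_transpose_def)
  from arg_cong[OF this, of cnj] show ?thesis by (simp add: mult.commute split: if_splits)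
qed

text \<open>The inner products are the Fourier coefficients of the entries of G^* F. Biorthogonality
  thus says that each entry has the coefficients of a constant, namely the Kronecker delta on
  H.\<close>

lemma biorthogonal_iff_inverse:
  assumes f: "bounded_transfer f" and g: "bounded_transfer g"
  shows "(\<forall>\<gamma>\<in>carrier \<Gamma>. \<forall>\<eta>\<in>carrier \<Gamma>.
      ell2_inner (carrier \<Gamma>) (left_regular \<Gamma> \<gamma> f) (left_regular \<Gamma> \<eta> g) = (if \<gamma> = \<eta> then 1 else 0)) \<longleftrightarrow>
    (AE \<xi> in \<mu>. is_inverse_matrix (carrier H) (conjugate_transpose (transfer f \<xi>)) (transfer g \<xi>))"
  (is "?bi \<longleftrightarrow> ?inv")
proof
  have inner: "ell2_inner (carrier \<Gamma>) (left_regular \<Gamma> (m', l') f) (left_regular \<Gamma> (m, l) g)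
      = (\<Sum>h\<in>carrier H. \<integral>\<xi>. transfer f \<xi> h l' * cnj (transfer g \<xi> h l) * \<xi> (m \<otimes> inv m') \<partial>\<mu>)"
    if "m \<in> carrier N" "l \<in> carrier H" "m' \<in> carrier N" "l' \<in> carrier H" for m l m' l'
    unfolding ell2_inner_def by (rule infsumI[OF gram_columns[OF f g that]])
  {
    assume bi: ?bi
    have "AE \<xi> in \<mu>. (\<Sum>h\<in>carrier H. transfer f \<xi> h i * cnj (transfer g \<xi> h j)) = (if i = j then 1 else 0)"
      if ij: "i \<in> carrier H" "j \<in> carrier H" for i j
    proof (rule sum_transform_products_AE[OF finite_H])
      fix k assume k: "k \<in> carrier N"
      \<comment> \<open>Placing the first vector at (\<one>, i) makes the relative shift equal to k,
        so every Fourier coefficient of the entry is reached.\<close>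
      have "ell2_inner (carrier \<Gamma>) (left_regular \<Gamma> (\<one>, i) f) (left_regular \<Gamma> (k, j) g)
          = (if (\<one>, i) = (k, j) then 1 else 0)"
        using bi ij k by (simp add: carrier_\<Gamma>)
      then show "(\<Sum>h\<in>carrier H. \<integral>\<xi>. transfer f \<xi> h i * cnj (transfer g \<xi> h j) * \<xi> k \<partial>\<mu>)
          = (if k = \<one> then (if i = j then 1 else 0) else 0)"
        using inner[of k j \<one> i] ij k by (auto split: if_splits)
    qed (use bounded_transferD[OF f] bounded_transferD[OF g] ij in auto)
    \<comment> \<open>There are finitely many pairs of indices, so their exceptional null sets have
      a null union.\<close>
    then show ?inv
      unfolding is_inverse_transfer_iff by (intro AE_finite_allI finite_H)
  }
  assume inv: ?inv
  have "ell2_inner (carrier \<Gamma>) (left_regular \<Gamma> (m', l') f) (left_regular \<Gamma> (m, l) g)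
      = (if (m', l') = (m, l) then 1 else 0)"
    if ml: "m \<in> carrier N" "l \<in> carrier H" "m' \<in> carrier N" "l' \<in> carrier H" for m l m' l'
  proof -
    have "AE \<xi> in \<mu>. (\<Sum>h\<in>carrier H. transfer f \<xi> h l' * cnj (transfer g \<xi> h l)) = (if l' = l then 1 else 0)"
      using inv unfolding is_inverse_transfer_iff by eventually_elim (use ml in auto)
    then have "(\<Sum>h\<in>carrier H. \<integral>\<xi>. transfer f \<xi> h l' * cnj (transfer g \<xi> h l) * \<xi> (m \<otimes> inv m') \<partial>\<mu>)
        = (if m \<otimes> inv m' = \<one> then (if l' = l then 1 else 0) else 0)"
      using ml by (intro sum_integrals_of_AE_const finite_H essentially_bounded_mult essentially_bounded_cnj
          bounded_transferD(2)[OF f] bounded_transferD(2)[OF g]) auto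
    moreover have "m \<otimes> inv m' = \<one> \<longleftrightarrow> m' = m"
      using ml by (metis inv_closed inv_equality inv_inv r_inv)
    ultimately show ?thesis using inner[OF ml] by auto
  qed
  then show ?bi by (auto simp: carrier_\<Gamma>)
qed

text \<open>Almost everywhere F G^* is the identity, so its entries have no Fourier coefficients
  away from the identity of N. In operator terms, this identity gives surjectivity.\<close>

lemma completeness_of_inverse:
  assumes f: "bounded_transfer f" and g: "bounded_transfer g"
    and inv: "AE \<xi> in \<mu>. is_inverse_matrix (carrier H) (conjugate_transpose (transfer f \<xi>)) (transfer g \<xi>)"
    and x: "x \<in> carrier \<Gamma>" and y: "y \<in> carrier \<Gamma>"
  shows "(\<Sum>\<^sub>\<infinity>\<gamma>\<in>carrier \<Gamma>. left_regular \<Gamma> \<gamma> f x * cnj (left_regular \<Gamma> \<gamma> g y)) = (if x = y then 1 else 0)"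
proof -
  obtain n' h' n h where xy: "x = (n', h')" "y = (n, h)" by fastforce
  have mem: "n \<in> carrier N" "h \<in> carrier H" "n' \<in> carrier N" "h' \<in> carrier H"
    using x y by (auto simp: xy carrier_\<Gamma>)
  have "AE \<xi> in \<mu>. (\<Sum>l\<in>carrier H. transfer f \<xi> h' l * cnj (transfer g \<xi> h l)) = (if h' = h then 1 else 0)"
    using inv by eventually_elim (use mem in \<open>simp add: inverse_transfer_imp_rows\<close>)
  then have "(\<Sum>l\<in>carrier H. \<integral>\<xi>. transfer f \<xi> h' l * cnj (transfer g \<xi> h l) * \<xi> (inv n \<otimes> n') \<partial>\<mu>)
      = (if inv n \<otimes> n' = \<one> then (if h' = h then 1 else 0) else 0)"
    using mem by (intro sum_integrals_of_AE_const finite_H essentially_bounded_mult essentially_bounded_cnj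
        bounded_transferD(2)[OF f] bounded_transferD(2)[OF g]) auto
  moreover have "inv n \<otimes> n' = \<one> \<longleftrightarrow> n' = n"
    using mem by (metis inv_closed inv_equality inv_inv l_inv m_comm)
  ultimately show ?thesis
    using infsumI[OF gram_rows[OF f g mem]] by (auto simp: xy)
qed

text \<open>The matrix of f gives the operator that produces the basis, and the adjoint of the
  matrix of g gives its inverse; \<open>columns\<close> and \<open>rows\<close> are the two product
  identities.\<close>

lemma riesz_basis_of_inverse:
  assumes f: "bounded_transfer f" and g: "bounded_transfer g"
    and columns: "\<And>x y. x \<in> carrier \<Gamma> \<Longrightarrow> y \<in> carrier \<Gamma> \<Longrightarrow>
      ell2_inner (carrier \<Gamma>) (left_regular \<Gamma> y f) (left_regular \<Gamma> x g) = (if x = y then 1 else 0)"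
    and rows: "\<And>x y. x \<in> carrier \<Gamma> \<Longrightarrow> y \<in> carrier \<Gamma> \<Longrightarrow>
      (\<Sum>\<^sub>\<infinity>\<gamma>\<in>carrier \<Gamma>. left_regular \<Gamma> \<gamma> f x * cnj (left_regular \<Gamma> \<gamma> g y)) = (if x = y then 1 else 0)"
  shows "riesz_basis (carrier \<Gamma>) (carrier \<Gamma>) (\<lambda>\<gamma>. left_regular \<Gamma> \<gamma> f)"
proof -
  obtain C D where C: "C \<ge> 0" "bounded_matrix (carrier \<Gamma>) C (\<lambda>\<zeta> \<gamma>. left_regular \<Gamma> \<gamma> f \<zeta>)"
    and D: "D \<ge> 0" "bounded_matrix (carrier \<Gamma>) D (\<lambda>\<zeta> \<gamma>. left_regular \<Gamma> \<gamma> g \<zeta>)"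
    using bounded_matrix_left_regular[OF f] bounded_matrix_left_regular[OF g] by blast
  have "riesz_basis (carrier \<Gamma>) (carrier \<Gamma>)
      (\<lambda>\<gamma> \<zeta>. if \<zeta> \<in> carrier \<Gamma> then left_regular \<Gamma> \<gamma> f \<zeta> else 0)"
    using columns rows
    by (intro riesz_basis_matrix_columns[OF C(2,1) D(2,1)]) (simp_all add: ell2_inner_def mult.commute)
  \<comment> \<open>\<open>left_regular\<close> is already extended by zero, so cutting the columns
    off outside \<Gamma> changes nothing.\<close>
  moreover have "(\<lambda>\<zeta>. if \<zeta> \<in> carrier \<Gamma> then left_regular \<Gamma> \<gamma> f \<zeta> else 0) = left_regular \<Gamma> \<gamma> f" for \<gamma>
    by (auto simp: left_regular_def fun_eq_iff)
  ultimately show ?thesis by simp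
qed

lemma dual_riesz_bases_iff_inverse:
  assumes f: "bounded_transfer f" and g: "bounded_transfer g"
  shows "dual_riesz_bases (carrier \<Gamma>) (carrier \<Gamma>) (\<lambda>\<gamma>. left_regular \<Gamma> \<gamma> f) (\<lambda>\<gamma>. left_regular \<Gamma> \<gamma> g) \<longleftrightarrow>
    (AE \<xi> in \<mu>. is_inverse_matrix (carrier H) (conjugate_transpose (transfer f \<xi>)) (transfer g \<xi>))"
proof
  assume "dual_riesz_bases (carrier \<Gamma>) (carrier \<Gamma>) (\<lambda>\<gamma>. left_regular \<Gamma> \<gamma> f) (\<lambda>\<gamma>. left_regular \<Gamma> \<gamma> g)"
  then show "AE \<xi> in \<mu>. is_inverse_matrix (carrier H) (conjugate_transpose (transfer f \<xi>)) (transfer g \<xi>)"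
    using biorthogonal_iff_inverse[OF f g] by (simp add: dual_riesz_bases_def)
next
  assume inv: "AE \<xi> in \<mu>. is_inverse_matrix (carrier H) (conjugate_transpose (transfer f \<xi>)) (transfer g \<xi>)"
  have columns: "ell2_inner (carrier \<Gamma>) (left_regular \<Gamma> \<gamma> f) (left_regular \<Gamma> \<eta> g) = (if \<gamma> = \<eta> then 1 else 0)"
    if "\<gamma> \<in> carrier \<Gamma>" "\<eta> \<in> carrier \<Gamma>" for \<gamma> \<eta>
    using biorthogonal_iff_inverse[OF f g] inv that by blast
  note rows = completeness_of_inverse[OF f g inv]
  \<comment> \<open>Conjugating the two product identities exchanges f and g, so the second basis
    follows without returning to the matrices.\<close>
  have columns': "ell2_inner (carrier \<Gamma>) (left_regular \<Gamma> \<gamma> g) (left_regular \<Gamma> \<eta> f) = (if \<eta> = \<gamma> then 1 else 0)"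
    if "\<eta> \<in> carrier \<Gamma>" "\<gamma> \<in> carrier \<Gamma>" for \<gamma> \<eta>
  proof -
    have "ell2_inner (carrier \<Gamma>) (left_regular \<Gamma> \<gamma> g) (left_regular \<Gamma> \<eta> f)
        = cnj (ell2_inner (carrier \<Gamma>) (left_regular \<Gamma> \<eta> f) (left_regular \<Gamma> \<gamma> g))"
      unfolding ell2_inner_def infsum_cnj[symmetric] by (simp add: mult.commute)
    then show ?thesis using columns[OF that] by simp
  qed
  have rows': "(\<Sum>\<^sub>\<infinity>\<gamma>\<in>carrier \<Gamma>. left_regular \<Gamma> \<gamma> g x * cnj (left_regular \<Gamma> \<gamma> f y)) = (if x = y then 1 else 0)"
    if "x \<in> carrier \<Gamma>" "y \<in> carrier \<Gamma>" for x y
  proof -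
    have "(\<Sum>\<^sub>\<infinity>\<gamma>\<in>carrier \<Gamma>. left_regular \<Gamma> \<gamma> g x * cnj (left_regular \<Gamma> \<gamma> f y))
        = cnj (\<Sum>\<^sub>\<infinity>\<gamma>\<in>carrier \<Gamma>. left_regular \<Gamma> \<gamma> f y * cnj (left_regular \<Gamma> \<gamma> g x))"
      unfolding infsum_cnj[symmetric] by (simp add: mult.commute)
    then show ?thesis using rows[OF that(2,1)] by simp
  qed
  have "riesz_basis (carrier \<Gamma>) (carrier \<Gamma>) (\<lambda>\<gamma>. left_regular \<Gamma> \<gamma> f)"
    using columns rows by (intro riesz_basis_of_inverse[OF f g]) auto
  moreover have "riesz_basis (carrier \<Gamma>) (carrier \<Gamma>) (\<lambda>\<gamma>. left_regular \<Gamma> \<gamma> g)"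
    by (intro riesz_basis_of_inverse[OF g f] columns' rows')
  ultimately show "dual_riesz_bases (carrier \<Gamma>) (carrier \<Gamma>) (\<lambda>\<gamma>. left_regular \<Gamma> \<gamma> f) (\<lambda>\<gamma>. left_regular \<Gamma> \<gamma> g)"
    using columns by (simp add: dual_riesz_bases_def)
qed

end

theorem corollary8:
  fixes N :: "('n, 'c) monoid_scheme" and H :: "('h, 'd) monoid_scheme"
    and \<sigma> :: "'h \<Rightarrow> 'n \<Rightarrow> 'n" and \<kappa> :: nat
    and \<mu> :: "('n \<Rightarrow> complex) measure"
    and f g :: "'n \<times> 'h \<Rightarrow> complex"
  assumes "comm_group N"
    and "group H" and "finite (carrier H)" and "Coset.order H = \<kappa>"
    and "\<sigma> \<in> hom H (AutoGroup N)"
    and "haar_measure (dual_group N) (dual_topology N) \<mu>"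
    and "emeasure \<mu> (space \<mu>) = 1"
    and "f \<in> ell2 (carrier (semidirect_product N H \<sigma>))"
    and "g \<in> ell2 (carrier (semidirect_product N H \<sigma>))"
    and "\<forall>h\<in>carrier H. \<forall>l\<in>carrier H.
           essentially_bounded \<mu> (\<lambda>\<xi>. transfer_matrix N H \<sigma> \<mu> f \<xi> h l)"
    and "\<forall>h\<in>carrier H. \<forall>l\<in>carrier H.
           essentially_bounded \<mu> (\<lambda>\<xi>. transfer_matrix N H \<sigma> \<mu> g \<xi> h l)"
  shows "dual_riesz_bases
           (carrier (semidirect_product N H \<sigma>)) (carrier (semidirect_product N H \<sigma>))
           (\<lambda>\<gamma>. left_regular (semidirect_product N H \<sigma>) \<gamma> f)
           (\<lambda>\<gamma>. left_regular (semidirect_product N H \<sigma>) \<gamma> g)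
         \<longleftrightarrow>
         (AE \<xi> in \<mu>. is_inverse_matrix (carrier H)
            (conjugate_transpose (transfer_matrix N H \<sigma> \<mu> f \<xi>))
            (transfer_matrix N H \<sigma> \<mu> g \<xi>))"
proof -
  interpret semidirect_dual_haar N \<mu> H \<sigma>
    using assms
    by (intro semidirect_dual_haar.intro dual_haar.intro dual_haar_axioms.intro semidirect_dual_haar_axioms.intro)
  show ?thesis
    using assms by (intro dual_riesz_bases_iff_inverse) (simp_all add: bounded_transfer_def)
qed

end
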